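(* Let $d\ge2$ and let $\Gamma,\widetilde\Gamma$ be loop graphs with loop fundamental graphs $\Gamma_f,\widetilde\Gamma_f$ having the same number $\nu$ of vertices. Let $H$ and $\widetilde H$ be Schrödinger operators on $\Gamma$ and $\widetilde\Gamma$, respectively. Then the spectral bands $\sigma_n=[\lambda_n^-,\lambda_n^+]$, $\widetilde\sigma_n=[\widetilde\lambda_n^-,\widetilde\lambda_n^+]$, $n=1,\ldots,\nu$, and the gaps $\gamma_n=[\lambda_n^+,\lambda_{n+1}^-]$, $\widetilde\gamma_n=[\widetilde\lambda_n^+,\widetilde\lambda_{n+1}^-]$, $n=1,\ldots,\nu-1$, of $H$ and $\widetilde H$ satisfy the following estimates, where $\|V\|_1=\sum_{j,k=1}^\nu|V_{jk}|$: (i) If $\Gamma$ and $\widetilde\Gamma$ are bipartite and regular of the same degree $\varkappa_+$ and $H=\Delta$, $\widetilde H=\widetilde\Delta$, then $$\sum_{n=1}^{\nu-1}\big||\gamma_n|-|\widetilde\gamma_n|\big|\le4C,\qquad\sum_{n=1}^\nu\big||\sigma_n|-|\widetilde\sigma_n|\big|\le4C,\qquad C=\|\Delta(0)-\widetilde\Delta(0)\|_1.$$ (ii) If $\Gamma$ is precise with a precise quasimomentum $\vartheta_0$, $\widetilde\Gamma$ is bipartite and regular of degree $\varkappa_+$ and $\widetilde H=\widetilde\Delta$, then $$|\lambda_1^-|+|2\varkappa_+-\lambda_\nu^+|+\sum_{n=1}^{\nu-1}\big||\gamma_n|-|\widetilde\gamma_n|\big|\le2C,\qquad\sum_{n=1}^\nu\big||\sigma_n|-|\widetilde\sigma_n|\big|\le2C,$$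 $$C=C(\vartheta_0)=\|H(0)-\widetilde\Delta(0)\|_1+\|H(\vartheta_0)+\widetilde\Delta(0)-2\varkappa_+\mathbf 1_\nu\|_1,$$ where $\mathbf 1_\nu$ is the $\nu\times\nu$ identity matrix.
   Context: A $\mathbb Z^d$-periodic graph $\Gamma=(V,\mathcal E)$ ($d\ge2$) is a connected graph embedded in $\mathbb R^d$, possibly with loops and multiple edges, with vertex set $V$ and set $\mathcal E$ of unoriented edges, such that: any bounded domain of $\mathbb R^d$ contains finitely many vertices; every vertex has finite degree (number of incident edges, a loop counted twice); and there is a basis $a_1,\ldots,a_d$ of $\mathbb R^d$ (the periods) with $\Gamma+a_s=\Gamma$ for $s=1,\ldots,d$. Coordinates are taken with some origin and axes along $a_1,\ldots,a_d$, so that $\Gamma+m=\Gamma$ for all $m\in\mathbb Z^d$. Each unoriented edge gives two oriented edges $(u,v)$ and $(v,u)$ (an unoriented loop gives two oriented loops); $\mathcal A$ is the set of oriented edges. The fundamental graph is $\Gamma_f=\Gamma/\mathbb Z^d$; it is finite, its vertices are identified with $V\cap[0,1)^d=\{v_1,\ldots,v_\nu\}$, and $\mathcal A_f=\mathcal A/\mathbb Z^d$ is its set of oriented edges. Every $v\in V$ is uniquely $v=[v]+\tilde v$ with $[v]\in\mathbb Z^d$, $\tilde v\in V\cap[0,1)^d$. The index of $\mathbf e=(u,v)\in\mathcal A$ is $\tau(\mathbf e)=[v]-[u]\in\mathbb Z^d$; it is $\mathbb Z^d$-translation invariant and defines the index of the corresponding edge of $\mathcal A_f$. Edges of $\mathcal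 A_f$ with nonzero index are called bridges; $\mathcal B_f$ is the set of bridges. A periodic graph $\Gamma$ is called a loop graph if all bridges of some fundamental graph $\Gamma_f$ (for some choice of periods and origin) are loops; this $\Gamma_f$ is called a loop fundamental graph, and all coordinates, indices and Floquet matrices are taken with respect to it. A loop graph is called precise if $\cos\langle\tau(\mathbf e),\vartheta_0\rangle=-1$ for all $\mathbf e\in\mathcal B_f$ and some $\vartheta_0\in\mathbb T^d$, called a precise quasimomentum. A graph is bipartite if its vertex set splits into two disjoint parts such that each edge connects vertices from distinct parts; it is regular of degree $\varkappa_+$ if every vertex has degree $\varkappa_+$. $(\Delta f)(v)=\sum_{(v,u)_e\in\mathcal E}(f(v)-f(u))$ on $\ell^2(V)$; a Schrödinger operator is $H=\Delta+Q$ with $Q$ multiplication by a real function with $Q(v+m)=Q(v)$, $m\in\mathbb Z^d$; $q_j=Q(v_j)$. The Floquet matrices, for $\vartheta\in\mathbb T^d=\mathbb R^d/(2\pi\mathbb Z)^d$, are $H(\vartheta)=\Delta(\vartheta)+\mathrm{diag}(q_1,\ldots,q_\nu)$, $\Delta_{jk}(\vartheta)=\varkappa_j\delta_{jk}-\sum_{\mathbf e=(v_j,v_k)\in\mathcal A_f}e^{i\langle\tau(\mathbf e),\vartheta\rangle}$, $\varkappa_j=\deg v_j$. The eigenvalues of $H(\vartheta)$ are $\lambda_1(\vartheta)\le\ldots\le\lambda_\nu(\vartheta)$ (with multiplicity), and the spectral bands are $\sigma_n=[\lambda_n^-,\lambda_n^+]=\lambda_n(\mathbb T^d)$. Objects for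 $\widetilde\Gamma,\widetilde H$ carry a tilde. Lengths: $|\sigma_n|=\lambda_n^+-\lambda_n^-$, $|\gamma_n|=\lambda_{n+1}^--\lambda_n^+$ (possibly negative if consecutive bands overlap). *)

theory Defs
  imports
    "HOL-Analysis.Analysis"
    "HOL-Library.Uprod"
    "HOL-Computational_Algebra.Polynomial"
    "Graph_Theory.Digraph_Component"
    "Jordan_Normal_Form.Char_Poly"
begin

hide_const (open) Finite_Cartesian_Product.mat Determinants.det
no_notation vec_index (infixl \<open>$\<close> 100)
no_notation scalar_prod (infix \<open>\<bullet>\<close> 70)

section \<open>Multigraphs in Euclidean space\<close>

text \<open>
  An unoriented edge is an unordered pair of endpoints (equal for a loop) together with a label.
  The label tells parallel edges apart; it may be thought of as the shape of the edge, which is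
  why translations move the endpoints and keep the label. Whether edges meet each other in
  \<open>\<real>\<^sup>d\<close> is irrelevant here and is not restricted.
\<close>

record ('a, 'l) multigraph =
  vertices :: "'a set"
  edges :: "('a uprod \<times> 'l) set"

definition incident :: "('a, 'l) multigraph \<Rightarrow> 'a \<Rightarrow> ('a uprod \<times> 'l) set" where
  "incident \<Gamma> v = {e \<in> edges \<Gamma>. v \<in> set_uprod (fst e)}"

definition vertex_degree :: "('a, 'l) multigraph \<Rightarrow> 'a \<Rightarrow> nat" where
  "vertex_degree \<Gamma> v = card (incident \<Gamma> v) + card {e \<in> edges \<Gamma>. fst e = Upair v v}"

definition regular_graph :: "('a, 'l) multigraph \<Rightarrow> nat \<Rightarrow> bool" where
  "regular_graph \<Gamma> \<kappa> \<longleftrightarrow> (\<forall>v \<in> vertices \<Gamma>. vertex_degree \<Gamma> v = \<kappa>)"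

definition bipartite :: "('a, 'l) multigraph \<Rightarrow> bool" where
  "bipartite \<Gamma> \<longleftrightarrow> (\<exists>V\<^sub>1 V\<^sub>2. V\<^sub>1 \<union> V\<^sub>2 = vertices \<Gamma> \<and> V\<^sub>1 \<inter> V\<^sub>2 = {} \<and>
     (\<forall>e \<in> edges \<Gamma>. \<exists>u \<in> V\<^sub>1. \<exists>v \<in> V\<^sub>2. fst e = Upair u v))"

text \<open>
  An oriented edge is \<open>(tail, head, label, flag)\<close>. For an edge with distinct endpoints the two
  orientations differ in tail and head, and the flag is \<open>False\<close>; the flag is needed only so
  that a loop also gives two oriented edges.
\<close>

type_synonym ('a, 'l) oriented_edge = "'a \<times> 'a \<times> 'l \<times> bool"

definition oriented_edges :: "('a, 'l) multigraph \<Rightarrow> ('a, 'l) oriented_edge set" where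
  "oriented_edges \<Gamma> = {(u, v, l, b). (Upair u v, l) \<in> edges \<Gamma> \<and> (b \<longrightarrow> u = v)}"

definition oriented_graph ::
    "('a, 'l) multigraph \<Rightarrow> ('a, ('a, 'l) oriented_edge) pre_digraph" where
  "oriented_graph \<Gamma> = \<lparr>verts = vertices \<Gamma>, arcs = oriented_edges \<Gamma>,
     tail = (\<lambda>(u, v, l, b). u), head = (\<lambda>(u, v, l, b). v)\<rparr>"

definition translate_graph :: "'a::ab_group_add \<Rightarrow> ('a, 'l) multigraph \<Rightarrow> ('a, 'l) multigraph" where
  "translate_graph a \<Gamma> = \<lparr>vertices = (+) a ` vertices \<Gamma>,
     edges = (\<lambda>(p, l). (map_uprod ((+) a) p, l)) ` edges \<Gamma>\<rparr>"

section \<open>Periodic graphs and fundamental graphs\<close>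

text \<open>The dimension \<open>d\<close> is the cardinality of the finite index type \<open>'n\<close>.\<close>

definition periods :: "(real^'n, 'l) multigraph \<Rightarrow> ('n \<Rightarrow> real^'n) \<Rightarrow> bool" where
  "periods \<Gamma> a \<longleftrightarrow> inj a \<and> independent (range a) \<and> span (range a) = UNIV \<and>
     (\<forall>s. translate_graph (a s) \<Gamma> = \<Gamma>)"

definition periodic_graph :: "(real^'n, 'l) multigraph \<Rightarrow> bool" where
  "periodic_graph \<Gamma> \<longleftrightarrow>
     (\<forall>e \<in> edges \<Gamma>. set_uprod (fst e) \<subseteq> vertices \<Gamma>) \<and>
     Digraph_Component.connected (oriented_graph \<Gamma>) \<and>
     (\<forall>B. bounded B \<longrightarrow> finite (vertices \<Gamma> \<inter> B)) \<and>
     (\<forall>v \<in> vertices \<Gamma>. finite (incident \<Gamma> v)) \<and>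
     (\<exists>a. periods \<Gamma> a)"

definition lattice_vector :: "('n \<Rightarrow> real^'n) \<Rightarrow> int^'n \<Rightarrow> real^'n" where
  "lattice_vector a m = (\<Sum>s\<in>UNIV. of_int (m $ s) *\<^sub>R a s)"

text \<open>
  In what follows \<open>a\<close> are the periods and \<open>x\<^sub>0\<close> is the origin. Points are kept in the ambient
  space, and the coordinates \<open>x\<close> of \<open>v\<close> are those with \<open>v = x\<^sub>0 + (\<Sum>s. x\<^sub>s a\<^sub>s)\<close>.
\<close>

definition coordinates :: "('n \<Rightarrow> real^'n) \<Rightarrow> real^'n \<Rightarrow> real^'n \<Rightarrow> real^'n" where
  "coordinates a x\<^sub>0 v = (\<chi> s. representation (range a) (v - x\<^sub>0) (a s))"

definition integer_part :: "('n \<Rightarrow> real^'n) \<Rightarrow> real^'n \<Rightarrow> real^'n \<Rightarrow> int^'n" where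
  "integer_part a x\<^sub>0 v = (\<chi> s. \<lfloor>coordinates a x\<^sub>0 v $ s\<rfloor>)"

definition fractional_part :: "('n \<Rightarrow> real^'n) \<Rightarrow> real^'n \<Rightarrow> real^'n \<Rightarrow> real^'n" where
  "fractional_part a x\<^sub>0 v = v - lattice_vector a (integer_part a x\<^sub>0 v)"

definition fundamental_vertices ::
    "(real^'n, 'l) multigraph \<Rightarrow> ('n \<Rightarrow> real^'n) \<Rightarrow> real^'n \<Rightarrow> (real^'n) set" where
  "fundamental_vertices \<Gamma> a x\<^sub>0 =
     {v \<in> vertices \<Gamma>. \<forall>s. 0 \<le> coordinates a x\<^sub>0 v $ s \<and> coordinates a x\<^sub>0 v $ s < 1}"

definition translate_edge ::
    "'a::ab_group_add \<Rightarrow> ('a, 'l) oriented_edge \<Rightarrow> ('a, 'l) oriented_edge" where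
  "translate_edge a = (\<lambda>(u, v, l, b). (a + u, a + v, l, b))"

definition translation_equivalence ::
    "(real^'n, 'l) multigraph \<Rightarrow> ('n \<Rightarrow> real^'n) \<Rightarrow> (real^'n, 'l) oriented_edge rel" where
  "translation_equivalence \<Gamma> a = {(e, e'). e \<in> oriented_edges \<Gamma> \<and> e' \<in> oriented_edges \<Gamma> \<and>
     (\<exists>m. e' = translate_edge (lattice_vector a m) e)}"

text \<open>
  The oriented edges of the fundamental graph are the translation classes of oriented edges.
  Tail, head and index of a class are the common values on its members (\<^const>\<open>the_elem\<close> of a
  singleton).
\<close>

definition fundamental_graph ::
    "(real^'n, 'l) multigraph \<Rightarrow> ('n \<Rightarrow> real^'n) \<Rightarrow> real^'n \<Rightarrow>
     (real^'n, (real^'n, 'l) oriented_edge set) pre_digraph" where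
  "fundamental_graph \<Gamma> a x\<^sub>0 = \<lparr>verts = fundamental_vertices \<Gamma> a x\<^sub>0,
     arcs = oriented_edges \<Gamma> // translation_equivalence \<Gamma> a,
     tail = (\<lambda>E. the_elem ((\<lambda>e. fractional_part a x\<^sub>0 (tail (oriented_graph \<Gamma>) e)) ` E)),
     head = (\<lambda>E. the_elem ((\<lambda>e. fractional_part a x\<^sub>0 (head (oriented_graph \<Gamma>) e)) ` E))\<rparr>"

definition edge_index ::
    "('n \<Rightarrow> real^'n) \<Rightarrow> real^'n \<Rightarrow> (real^'n, 'l) oriented_edge \<Rightarrow> int^'n" where
  "edge_index a x\<^sub>0 = (\<lambda>(u, v, l, b). integer_part a x\<^sub>0 v - integer_part a x\<^sub>0 u)"

definition class_index ::
    "('n \<Rightarrow> real^'n) \<Rightarrow> real^'n \<Rightarrow> (real^'n, 'l) oriented_edge set \<Rightarrow> int^'n" where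
  "class_index a x\<^sub>0 E = the_elem (edge_index a x\<^sub>0 ` E)"

definition bridges ::
    "(real^'n, 'l) multigraph \<Rightarrow> ('n \<Rightarrow> real^'n) \<Rightarrow> real^'n \<Rightarrow> (real^'n, 'l) oriented_edge set set" where
  "bridges \<Gamma> a x\<^sub>0 = {E \<in> arcs (fundamental_graph \<Gamma> a x\<^sub>0). class_index a x\<^sub>0 E \<noteq> 0}"

definition loop_fundamental_graph ::
    "(real^'n, 'l) multigraph \<Rightarrow> ('n \<Rightarrow> real^'n) \<Rightarrow> real^'n \<Rightarrow> bool" where
  "loop_fundamental_graph \<Gamma> a x\<^sub>0 \<longleftrightarrow> periods \<Gamma> a \<and>
     (\<forall>E \<in> bridges \<Gamma> a x\<^sub>0.
        tail (fundamental_graph \<Gamma> a x\<^sub>0) E = head (fundamental_graph \<Gamma> a x\<^sub>0) E)"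

definition loop_graph :: "(real^'n, 'l) multigraph \<Rightarrow> bool" where
  "loop_graph \<Gamma> \<longleftrightarrow> periodic_graph \<Gamma> \<and> (\<exists>a x\<^sub>0. loop_fundamental_graph \<Gamma> a x\<^sub>0)"

definition pairing :: "int^'n \<Rightarrow> real^'n \<Rightarrow> real" where
  "pairing m \<theta> = (\<Sum>s\<in>UNIV. of_int (m $ s) * \<theta> $ s)"

text \<open>
  A quasimomentum in \<open>\<real>\<^sup>d / (2\<pi>\<int>)\<^sup>d\<close> is given by any representative in \<open>\<real>\<^sup>d\<close>.
\<close>

definition precise_quasimomentum ::
    "(real^'n, 'l) multigraph \<Rightarrow> ('n \<Rightarrow> real^'n) \<Rightarrow> real^'n \<Rightarrow> real^'n \<Rightarrow> bool" where
  "precise_quasimomentum \<Gamma> a x\<^sub>0 \<theta>\<^sub>0 \<longleftrightarrow>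
     (\<forall>E \<in> bridges \<Gamma> a x\<^sub>0. cos (pairing (class_index a x\<^sub>0 E) \<theta>\<^sub>0) = - 1)"

definition precise ::
    "(real^'n, 'l) multigraph \<Rightarrow> ('n \<Rightarrow> real^'n) \<Rightarrow> real^'n \<Rightarrow> bool" where
  "precise \<Gamma> a x\<^sub>0 \<longleftrightarrow> (\<exists>\<theta>\<^sub>0. precise_quasimomentum \<Gamma> a x\<^sub>0 \<theta>\<^sub>0)"

definition vertex_numbering ::
    "(real^'n, 'l) multigraph \<Rightarrow> ('n \<Rightarrow> real^'n) \<Rightarrow> real^'n \<Rightarrow> (real^'n) list \<Rightarrow> bool" where
  "vertex_numbering \<Gamma> a x\<^sub>0 vs \<longleftrightarrow> distinct vs \<and> set vs = fundamental_vertices \<Gamma> a x\<^sub>0"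

section \<open>Schroedinger operators and Floquet matrices\<close>

text \<open>
  The operators are given by their formula on all complex functions on the vertex set, the value
  outside the vertex set being set to \<open>0\<close>. In the sum over incident edges a loop contributes \<open>0\<close>.
\<close>

definition laplacian ::
    "('a, 'l) multigraph \<Rightarrow> ('a \<Rightarrow> complex) \<Rightarrow> 'a \<Rightarrow> complex" where
  "laplacian \<Gamma> f v = (if v \<in> vertices \<Gamma>
     then \<Sum>e \<in> out_arcs (oriented_graph \<Gamma>) v. f v - f (head (oriented_graph \<Gamma>) e) else 0)"

definition schroedinger ::
    "('a, 'l) multigraph \<Rightarrow> ('a \<Rightarrow> real) \<Rightarrow> ('a \<Rightarrow> complex) \<Rightarrow> 'a \<Rightarrow> complex" where
  "schroedinger \<Gamma> Q f v =
     laplacian \<Gamma> f v + (if v \<in> vertices \<Gamma> then of_real (Q v) * f v else 0)"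

definition periodic_potential ::
    "(real^'n, 'l) multigraph \<Rightarrow> ('n \<Rightarrow> real^'n) \<Rightarrow> (real^'n \<Rightarrow> real) \<Rightarrow> bool" where
  "periodic_potential \<Gamma> a Q \<longleftrightarrow>
     (\<forall>v \<in> vertices \<Gamma>. \<forall>m. Q (v + lattice_vector a m) = Q v)"

definition floquet_laplacian ::
    "(real^'n, 'l) multigraph \<Rightarrow> ('n \<Rightarrow> real^'n) \<Rightarrow> real^'n \<Rightarrow> (real^'n) list \<Rightarrow>
     real^'n \<Rightarrow> complex mat" where
  "floquet_laplacian \<Gamma> a x\<^sub>0 vs \<theta> = Matrix.mat (length vs) (length vs) (\<lambda>(j, k).
     (if j = k then of_nat (vertex_degree \<Gamma> (vs ! j)) else 0) -
     (\<Sum>E | E \<in> arcs (fundamental_graph \<Gamma> a x\<^sub>0) \<and>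
             tail (fundamental_graph \<Gamma> a x\<^sub>0) E = vs ! j \<and>
             head (fundamental_graph \<Gamma> a x\<^sub>0) E = vs ! k.
        exp (\<i> * of_real (pairing (class_index a x\<^sub>0 E) \<theta>))))"

definition floquet_matrix ::
    "(real^'n, 'l) multigraph \<Rightarrow> ('n \<Rightarrow> real^'n) \<Rightarrow> real^'n \<Rightarrow> (real^'n) list \<Rightarrow>
     (real^'n \<Rightarrow> real) \<Rightarrow> real^'n \<Rightarrow> complex mat" where
  "floquet_matrix \<Gamma> a x\<^sub>0 vs Q \<theta> = floquet_laplacian \<Gamma> a x\<^sub>0 vs \<theta> +
     Matrix.mat (length vs) (length vs) (\<lambda>(j, k). if j = k then of_real (Q (vs ! j)) else 0)"

text \<open>
  Floquet matrices are Hermitian, so the roots of the characteristic polynomial are real and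
  taking real parts only changes the type.
\<close>

definition sorted_eigenvalues :: "complex mat \<Rightarrow> real list" where
  "sorted_eigenvalues A = sorted_list_of_multiset (image_mset Re (proots (char_poly A)))"

definition band_function ::
    "(real^'n, 'l) multigraph \<Rightarrow> ('n \<Rightarrow> real^'n) \<Rightarrow> real^'n \<Rightarrow> (real^'n) list \<Rightarrow>
     (real^'n \<Rightarrow> real) \<Rightarrow> nat \<Rightarrow> real^'n \<Rightarrow> real" where
  "band_function \<Gamma> a x\<^sub>0 vs Q n \<theta> = sorted_eigenvalues (floquet_matrix \<Gamma> a x\<^sub>0 vs Q \<theta>) ! (n - 1)"

definition spectral_band ::
    "(real^'n, 'l) multigraph \<Rightarrow> ('n \<Rightarrow> real^'n) \<Rightarrow> real^'n \<Rightarrow> (real^'n) list \<Rightarrow>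
     (real^'n \<Rightarrow> real) \<Rightarrow> nat \<Rightarrow> real set" where
  "spectral_band \<Gamma> a x\<^sub>0 vs Q n = range (band_function \<Gamma> a x\<^sub>0 vs Q n)"

definition band_min ::
    "(real^'n, 'l) multigraph \<Rightarrow> ('n \<Rightarrow> real^'n) \<Rightarrow> real^'n \<Rightarrow> (real^'n) list \<Rightarrow>
     (real^'n \<Rightarrow> real) \<Rightarrow> nat \<Rightarrow> real" where
  "band_min \<Gamma> a x\<^sub>0 vs Q n = Inf (spectral_band \<Gamma> a x\<^sub>0 vs Q n)"

definition band_max ::
    "(real^'n, 'l) multigraph \<Rightarrow> ('n \<Rightarrow> real^'n) \<Rightarrow> real^'n \<Rightarrow> (real^'n) list \<Rightarrow>
     (real^'n \<Rightarrow> real) \<Rightarrow> nat \<Rightarrow> real" where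
  "band_max \<Gamma> a x\<^sub>0 vs Q n = Sup (spectral_band \<Gamma> a x\<^sub>0 vs Q n)"

definition band_length ::
    "(real^'n, 'l) multigraph \<Rightarrow> ('n \<Rightarrow> real^'n) \<Rightarrow> real^'n \<Rightarrow> (real^'n) list \<Rightarrow>
     (real^'n \<Rightarrow> real) \<Rightarrow> nat \<Rightarrow> real" where
  "band_length \<Gamma> a x\<^sub>0 vs Q n = band_max \<Gamma> a x\<^sub>0 vs Q n - band_min \<Gamma> a x\<^sub>0 vs Q n"

text \<open>The gap length is signed: it is negative when consecutive bands overlap.\<close>

definition gap_length ::
    "(real^'n, 'l) multigraph \<Rightarrow> ('n \<Rightarrow> real^'n) \<Rightarrow> real^'n \<Rightarrow> (real^'n) list \<Rightarrow>
     (real^'n \<Rightarrow> real) \<Rightarrow> nat \<Rightarrow> real" where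
  "gap_length \<Gamma> a x\<^sub>0 vs Q n = band_min \<Gamma> a x\<^sub>0 vs Q (n + 1) - band_max \<Gamma> a x\<^sub>0 vs Q n"

definition entry_norm1 :: "complex mat \<Rightarrow> real" where
  "entry_norm1 A = (\<Sum>j<dim_row A. \<Sum>k<dim_col A. cmod (A $$ (j, k)))"

end

theory Submission
  imports Defs "Jordan_Normal_Form.Schur_Decomposition"
begin

no_notation vec_index (infixl \<open>$\<close> 100)
no_notation scalar_prod (infix \<open>\<bullet>\<close> 70)

text \<open>
  All bridges of a loop fundamental graph are loops, so only the diagonal of the Floquet matrix
  \<open>H(\<theta>)\<close> depends on \<open>\<theta>\<close>, and each diagonal entry is smallest at \<open>\<theta> = 0\<close> and largest at a precise
  quasimomentum \<open>\<theta>\<^sub>0\<close>. By monotonicity of eigenvalues the band edges are the eigenvalues of \<open>H(0)\<close> and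
  \<open>H(\<theta>\<^sub>0)\<close>. For a bipartite regular graph a precise quasimomentum exists and \<open>\<Delta>(\<theta>\<^sub>0)\<close> is conjugate, by a
  diagonal matrix of signs, to \<open>2\<kappa> - \<Delta>(0)\<close>. Everything is thereby reduced to
  \<open>\<Sum>\<^sub>i \<bar>\<lambda>\<^sub>i(A) - \<lambda>\<^sub>i(B)\<bar> \<le> 2 \<parallel>A - B\<parallel>\<^sub>1\<close> for Hermitian \<open>A\<close>, \<open>B\<close>: with \<open>D\<close> the diagonal matrix of the absolute
  row sums of \<open>A - B\<close>, both \<open>A\<close> and \<open>B\<close> lie between \<open>B - D\<close> and \<open>B + D\<close>, hence the sum is at most
  \<open>tr (B + D) - tr (B - D)\<close>.
\<close>

section \<open>Spectral theorem for Hermitian matrices\<close>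

text \<open>The quantity to bound is a sum of absolute values, whereas traces control only signed
  sums. Bracketing both matrices between the same pair \<open>B - D\<close>, \<open>B + D\<close>
  bounds every term by a nonnegative difference of two eigenvalues, and those differences add up to
  a trace; this costs the factor 2. Row sums are a suitable diagonal because 2 |x_i| |x_j| \<le>
  |x_i|^2 + |x_j|^2 spreads each off-diagonal entry of a Hermitian matrix over the diagonal. Lower
  and upper band edges are compared separately. In (i) the matrices for the upper edges are
  2\<kappa> minus those for the lower edges, so the same norm C occurs twice, whence 4C; in (ii) the
  two comparisons give the two summands of C(\<theta>_0). The gaps contain every band edge exactly
  once except the lowest and the highest. For the comparison graph in (ii) these two are 0 and
  2\<kappa>, which is how |\<lambda>_1^-| and |2\<kappa> - \<lambda>_\<nu>^+| join the gap sum at no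
  extra cost.\<close>

lemma mat_adjoint_carrier [simp]: "A \<in> carrier_mat n m \<Longrightarrow> mat_adjoint A \<in> carrier_mat m n"
  unfolding mat_adjoint_def by auto

lemma dim_mat_adjoint [simp]:
  "dim_row (mat_adjoint A) = dim_col A" "dim_col (mat_adjoint A) = dim_row A"
  unfolding mat_adjoint_def by auto

lemma mat_adjoint_index:
  fixes A :: "complex mat"
  assumes "A \<in> carrier_mat n m" "i < m" "j < n"
  shows "mat_adjoint A $$ (i, j) = cnj (A $$ (j, i))"
  using assms unfolding mat_adjoint_def mat_of_rows_def by (auto simp: vec_index_conjugate)

lemma index_mult_mat_sum:
  fixes A B :: "complex mat"
  assumes "A \<in> carrier_mat n m" "B \<in> carrier_mat m k" "i < n" "j < k"
  shows "(A * B) $$ (i, j) = (\<Sum>l<m. A $$ (i, l) * B $$ (l, j))"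
proof -
  have "(A * B) $$ (i, j) = scalar_prod (Matrix.row A i) (col B j)"
    using assms by auto
  also have "\<dots> = (\<Sum>l<m. A $$ (i, l) * B $$ (l, j))"
    using assms unfolding scalar_prod_def lessThan_atLeast0 by (intro sum.cong) auto
  finally show ?thesis .
qed

lemma mat_adjoint_mult:
  fixes A B :: "complex mat"
  assumes A: "A \<in> carrier_mat n m" and B: "B \<in> carrier_mat m k"
  shows "mat_adjoint (A * B) = mat_adjoint B * mat_adjoint A"
proof (rule eq_matI)
  note AB = mult_carrier_mat[OF A B]
  show "dim_row (mat_adjoint (A * B)) = dim_row (mat_adjoint B * mat_adjoint A)"
    "dim_col (mat_adjoint (A * B)) = dim_col (mat_adjoint B * mat_adjoint A)"
    using A B mat_adjoint_carrier[OF AB] mat_adjoint_carrier[OF A] mat_adjoint_carrier[OF B] by auto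
  fix i j assume "i < dim_row (mat_adjoint B * mat_adjoint A)" "j < dim_col (mat_adjoint B * mat_adjoint A)"
  then have ij: "i < k" "j < n"
    using mat_adjoint_carrier[OF A] mat_adjoint_carrier[OF B] by auto
  show "mat_adjoint (A * B) $$ (i, j) = (mat_adjoint B * mat_adjoint A) $$ (i, j)"
    using ij
    by (auto simp del: index_mult_mat(1) simp: mult.commute mat_adjoint_index[OF AB] index_mult_mat_sum[OF A B] mat_adjoint_index[OF A]
        mat_adjoint_index[OF B] index_mult_mat_sum[OF mat_adjoint_carrier[OF B] mat_adjoint_carrier[OF A]]
        intro!: sum.cong)
qed

lemma mat_adjoint_adjoint:
  fixes A :: "complex mat"
  shows "mat_adjoint (mat_adjoint A) = A"
proof (rule eq_matI)
  have A: "A \<in> carrier_mat (dim_row A) (dim_col A)" by simp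
  note A' = mat_adjoint_carrier[OF A]
  note A'' = mat_adjoint_carrier[OF A']
  show "dim_row (mat_adjoint (mat_adjoint A)) = dim_row A"
    "dim_col (mat_adjoint (mat_adjoint A)) = dim_col A"
    using A'' by auto
  fix i j assume "i < dim_row A" "j < dim_col A"
  then show "mat_adjoint (mat_adjoint A) $$ (i, j) = A $$ (i, j)"
    using mat_adjoint_index[OF A'] mat_adjoint_index[OF A] by auto
qed

text \<open>Entrywise, because the Floquet matrices are given by their entries;
  \<open>hermitian_mat_iff_adjoint\<close> supplies the algebraic form for the
  diagonalisation.\<close>

definition hermitian_mat :: "nat \<Rightarrow> complex mat \<Rightarrow> bool" where
  "hermitian_mat n A \<longleftrightarrow> A \<in> carrier_mat n n \<and> (\<forall>i<n. \<forall>j<n. A $$ (j, i) = cnj (A $$ (i, j)))"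

lemma hermitian_mat_carrier: "hermitian_mat n A \<Longrightarrow> A \<in> carrier_mat n n"
  unfolding hermitian_mat_def by blast

lemma hermitian_matD: "hermitian_mat n A \<Longrightarrow> i < n \<Longrightarrow> j < n \<Longrightarrow> cnj (A $$ (i, j)) = A $$ (j, i)"
  unfolding hermitian_mat_def by metis

lemma hermitian_mat_iff_adjoint:
  assumes A: "A \<in> carrier_mat n n"
  shows "hermitian_mat n A \<longleftrightarrow> mat_adjoint A = A"
proof
  assume h: "hermitian_mat n A"
  show "mat_adjoint A = A"
  proof (rule eq_matI)
    fix i j assume "i < dim_row A" "j < dim_col A"
    then have ij: "i < n" "j < n" using A by auto
    show "mat_adjoint A $$ (i, j) = A $$ (i, j)"
      unfolding mat_adjoint_index[OF A ij] by (rule hermitian_matD[OF h ij(2) ij(1)])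
  qed (use A in auto)
next
  assume eq: "mat_adjoint A = A"
  have "A $$ (j, i) = cnj (A $$ (i, j))" if "i < n" "j < n" for i j
    using mat_adjoint_index[OF A that(2) that(1)] unfolding eq .
  then show "hermitian_mat n A"
    unfolding hermitian_mat_def using A by blast
qed

definition unitary_mat :: "nat \<Rightarrow> complex mat \<Rightarrow> bool" where
  "unitary_mat n U \<longleftrightarrow> U \<in> carrier_mat n n \<and> mat_adjoint U * U = 1\<^sub>m n"

lemma unitary_matD:
  assumes "unitary_mat n U"
  shows "U \<in> carrier_mat n n" "mat_adjoint U * U = 1\<^sub>m n" "U * mat_adjoint U = 1\<^sub>m n"
proof -
  show U: "U \<in> carrier_mat n n" and inv: "mat_adjoint U * U = 1\<^sub>m n"
    using assms unfolding unitary_mat_def by blast+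
  show "U * mat_adjoint U = 1\<^sub>m n"
    by (rule mat_mult_left_right_inverse[OF mat_adjoint_carrier[OF U] U inv])
qed

lemma unitary_mat_mult:
  assumes "unitary_mat n U" "unitary_mat n W"
  shows "unitary_mat n (U * W)"
proof -
  note U = unitary_matD[OF assms(1)] and W = unitary_matD[OF assms(2)]
  note U' = mat_adjoint_carrier[OF U(1)] and W' = mat_adjoint_carrier[OF W(1)]
  have "mat_adjoint (U * W) * (U * W) = mat_adjoint W * mat_adjoint U * (U * W)"
    by (simp add: mat_adjoint_mult[OF U(1) W(1)])
  also have "\<dots> = mat_adjoint W * (mat_adjoint U * (U * W))"
    by (rule assoc_mult_mat[OF W' U' mult_carrier_mat[OF U(1) W(1)]])
  also have "mat_adjoint U * (U * W) = mat_adjoint U * U * W"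
    by (rule assoc_mult_mat[symmetric, OF U' U(1) W(1)])
  also have "mat_adjoint W * \<dots> = 1\<^sub>m n"
    using U W by simp
  finally show ?thesis
    unfolding unitary_mat_def using U(1) W(1) by auto
qed

text \<open>Gram-Schmidt applied to a basis starting with v keeps v as first vector but yields only
  an orthogonal family. Normalising rescales v, so the first column is a nonzero multiple of
  v.\<close>

lemma orthonormal_basis_completion:
  fixes v :: "complex vec"
  assumes v: "v \<in> carrier_vec n" and v0: "v \<noteq> 0\<^sub>v n"
  shows "\<exists>U c. unitary_mat n U \<and> c \<noteq> 0 \<and> col U 0 = c \<cdot>\<^sub>v v"
proof -
  interpret cof_vec_space n "TYPE(complex)" .
  have n: "n \<noteq> 0" using v v0 by (auto intro: ccontr)
  define b where "b = basis_completion v"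
  define ws where "ws = gram_schmidt n b"
  note bc = basis_completion[OF v v0, folded b_def]
  have "b \<noteq> []" using bc(6) n by auto
  with bc(7) obtain vs where bv: "b = v # vs" by (cases b) auto
  have ws: "set ws \<subseteq> carrier_vec n" "corthogonal ws" "length ws = n"
    using gram_schmidt_result[OF bc(2) bc(4) bc(5) refl, folded ws_def] bc(6) by auto
  have hdws: "hd ws = v" using gram_schmidt_hd[OF v, of vs, folded bv] unfolding ws_def .
  \<comment> \<open>The reciprocal norm of the i-th orthogonal vector, whose conjugate product with
    itself is its squared norm.\<close>
  define r where "r i = complex_of_real (1 / sqrt (Re (ws ! i \<bullet>c ws ! i)))" for i
  define U where "U = Matrix.mat n n (\<lambda>(i, j). r j * vec_index (ws ! j) i)"
  have U: "U \<in> carrier_mat n n" unfolding U_def by simp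
  have wsc: "ws ! i \<in> carrier_vec n" if "i < n" for i using ws that by auto
  have sp: "ws ! j \<bullet>c ws ! i = (\<Sum>l<n. vec_index (ws ! j) l * cnj (vec_index (ws ! i) l))"
    if "i < n" "j < n" for i j
    using wsc[OF that(1)] wsc[OF that(2)] unfolding scalar_prod_def lessThan_atLeast0
    by (auto intro!: sum.cong)
  have self: "ws ! i \<bullet>c ws ! i = complex_of_real (Re (ws ! i \<bullet>c ws ! i))" "Re (ws ! i \<bullet>c ws ! i) > 0"
    if "i < n" for i
  proof -
    have eq: "ws ! i \<bullet>c ws ! i = complex_of_real (\<Sum>l<n. (cmod (vec_index (ws ! i) l))\<^sup>2)"
      unfolding sp[OF that that] of_real_sum by (intro sum.cong refl) (simp only: complex_norm_square)
    then have re: "Re (ws ! i \<bullet>c ws ! i) = (\<Sum>l<n. (cmod (vec_index (ws ! i) l))\<^sup>2)" by simp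
    show "ws ! i \<bullet>c ws ! i = complex_of_real (Re (ws ! i \<bullet>c ws ! i))" using eq re by simp
    have "ws ! i \<bullet>c ws ! i \<noteq> 0" using corthogonalD[OF ws(2), of i i] ws(3) that by auto
    then have "Re (ws ! i \<bullet>c ws ! i) \<noteq> 0" using eq re by (metis of_real_0)
    moreover have "Re (ws ! i \<bullet>c ws ! i) \<ge> 0" unfolding re by (intro sum_nonneg) auto
    ultimately show "Re (ws ! i \<bullet>c ws ! i) > 0" by linarith
  qed
  have rr: "r i * r i * (ws ! i \<bullet>c ws ! i) = 1" if "i < n" for i
  proof -
    let ?t = "Re (ws ! i \<bullet>c ws ! i)"
    have "r i * r i * (ws ! i \<bullet>c ws ! i) = r i * r i * complex_of_real ?t"
      using self(1)[OF that] by simp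
    also have "\<dots> = complex_of_real (1 / sqrt ?t * (1 / sqrt ?t) * ?t)"
      unfolding r_def by (simp only: of_real_mult)
    also have "1 / sqrt ?t * (1 / sqrt ?t) * ?t = 1"
      using self(2)[OF that] by (simp add: field_simps)
    finally show ?thesis by simp
  qed
  have "mat_adjoint U * U = 1\<^sub>m n"
  proof (rule eq_matI)
    fix i j assume "i < dim_row (1\<^sub>m n :: complex mat)" "j < dim_col (1\<^sub>m n :: complex mat)"
    then have ij: "i < n" "j < n" by auto
    have "(mat_adjoint U * U) $$ (i, j) = (\<Sum>l<n. cnj (U $$ (l, i)) * U $$ (l, j))"
      using ij by (simp add: index_mult_mat_sum[OF mat_adjoint_carrier[OF U] U] mat_adjoint_index[OF U])
    also have "\<dots> = (\<Sum>l<n. r i * r j * (vec_index (ws ! j) l * cnj (vec_index (ws ! i) l)))"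
      using ij by (intro sum.cong refl) (auto simp: U_def r_def)
    also have "\<dots> = r i * r j * (ws ! j \<bullet>c ws ! i)"
      unfolding sp[OF ij] sum_distrib_left ..
    also have "\<dots> = (if i = j then 1 else 0)"
    proof (cases "i = j")
      case True
      then show ?thesis using rr[OF ij(1)] by simp
    next
      case False
      then have "ws ! j \<bullet>c ws ! i = 0" using corthogonalD[OF ws(2), of j i] ws(3) ij by auto
      with False show ?thesis by simp
    qed
    finally show "(mat_adjoint U * U) $$ (i, j) = 1\<^sub>m n $$ (i, j)" using ij by simp
  qed (use mat_adjoint_carrier[OF U] U in auto)
  then have "unitary_mat n U" unfolding unitary_mat_def using U by simp
  moreover have "r 0 \<noteq> 0" using rr[of 0] n by auto
  moreover have "col U 0 = r 0 \<cdot>\<^sub>v v"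
  proof -
    have "ws ! 0 = v" using hdws ws(3) n by (cases ws) auto
    then show ?thesis using U v n by (intro eq_vecI) (auto simp: U_def)
  qed
  ultimately show ?thesis by blast
qed

lemma eigenvalue_exists:
  fixes A :: "complex mat"
  assumes A: "A \<in> carrier_mat n n" and "n \<noteq> 0"
  shows "\<exists>v e. v \<in> carrier_vec n \<and> v \<noteq> 0\<^sub>v n \<and> A *\<^sub>v v = e \<cdot>\<^sub>v v"
proof -
  obtain as where as: "char_poly A = (\<Prod>a\<leftarrow>as. [:- a, 1:])" "length as = n"
    using char_poly_factorized[OF A] by blast
  then obtain e as' where "as = e # as'" using assms(2) by (cases as) auto
  then have "poly (char_poly A) e = 0" using as by simp
  then have "eigenvalue A e" using eigenvalue_root_char_poly[OF A] by simp
  then show ?thesis unfolding eigenvalue_def eigenvector_def using A by auto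
qed

lemma hermitian_diag_entry_real:
  assumes "hermitian_mat n A" "i < n"
  shows "A $$ (i, i) = complex_of_real (Re (A $$ (i, i)))"
  using arg_cong[OF hermitian_matD[OF assms assms(2)], of Im] by (simp add: complex_eq_iff)

text \<open>Deflation. A unitary W whose first column is an eigenvector clears the first column of
  W^* A W below the diagonal; being Hermitian, this matrix has a cleared first row too, and the
  remaining block falls under the induction hypothesis.\<close>

theorem hermitian_spectral:
  assumes "hermitian_mat n A"
  shows "\<exists>U (l :: nat \<Rightarrow> real). unitary_mat n U \<and>
    mat_adjoint U * A * U = Matrix.mat n n (\<lambda>(i, j). if i = j then complex_of_real (l i) else 0)"
  using assms
proof (induction n arbitrary: A)
  case 0
  then show ?case
    using mat_adjoint_carrier[of "1\<^sub>m 0" 0 0]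
    by (intro exI[of _ "1\<^sub>m 0"] exI[of _ "\<lambda>_. 0"]) (auto simp: unitary_mat_def hermitian_mat_def intro!: eq_matI)
next
  case (Suc m)
  let ?n = "Suc m"
  note A = hermitian_mat_carrier[OF Suc.prems]
  obtain v e where v: "v \<in> carrier_vec ?n" "v \<noteq> 0\<^sub>v ?n" "A *\<^sub>v v = e \<cdot>\<^sub>v v"
    using eigenvalue_exists[OF A] by blast
  obtain W c where W: "unitary_mat ?n W" and c: "c \<noteq> 0" "col W 0 = c \<cdot>\<^sub>v v"
    using orthonormal_basis_completion[OF v(1,2)] by blast
  note Wc = unitary_matD(1)[OF W]
  note W' = mat_adjoint_carrier[OF Wc]
  define M where "M = mat_adjoint W * A * W"
  have M: "M \<in> carrier_mat ?n ?n"
    unfolding M_def by (rule mult_carrier_mat[OF mult_carrier_mat[OF W' A] Wc])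
  have "mat_adjoint A = A" using hermitian_mat_iff_adjoint[OF A] Suc.prems by simp
  then have "mat_adjoint M = M"
    unfolding M_def
    using mat_adjoint_mult[OF mult_carrier_mat[OF W' A] Wc] mat_adjoint_mult[OF W' A]
      assoc_mult_mat[OF W' A Wc] mat_adjoint_adjoint[of W] by simp
  then have hM: "hermitian_mat ?n M" using hermitian_mat_iff_adjoint[OF M] by simp
  have AW0: "col (A * W) 0 = e \<cdot>\<^sub>v col W 0"
  proof -
    have "col (A * W) 0 = A *\<^sub>v col W 0" using A Wc by (intro eq_vecI) auto
    also have "\<dots> = c \<cdot>\<^sub>v (A *\<^sub>v v)" unfolding c(2) using A v(1) by (rule mult_mat_vec)
    also have "\<dots> = e \<cdot>\<^sub>v col W 0" unfolding v(3) c(2) by (simp add: smult_smult_assoc mult.commute)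
    finally show ?thesis .
  qed
  \<comment> \<open>Column 0 of \<open>A * W\<close> is e times column 0 of \<open>W\<close>, and
    the adjoint of \<open>W\<close> sends that column to the first unit vector.\<close>
  have M0: "M $$ (i, 0) = (if i = 0 then e else 0)" if i: "i < ?n" for i
  proof -
    have "M $$ (i, 0) = (\<Sum>l<?n. mat_adjoint W $$ (i, l) * (A * W) $$ (l, 0))"
      unfolding M_def assoc_mult_mat[OF W' A Wc]
      using index_mult_mat_sum[OF W' mult_carrier_mat[OF A Wc] i] by simp
    also have "\<dots> = (\<Sum>l<?n. e * (mat_adjoint W $$ (i, l) * W $$ (l, 0)))"
    proof (intro sum.cong refl)
      fix l assume "l \<in> {..<?n}"
      then have "(A * W) $$ (l, 0) = vec_index (col (A * W) 0) l" using A Wc by simp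
      also have "\<dots> = e * W $$ (l, 0)" unfolding AW0 using \<open>l \<in> {..<?n}\<close> Wc by simp
      finally show "mat_adjoint W $$ (i, l) * (A * W) $$ (l, 0) = e * (mat_adjoint W $$ (i, l) * W $$ (l, 0))"
        by simp
    qed
    also have "\<dots> = e * (mat_adjoint W * W) $$ (i, 0)"
      using index_mult_mat_sum[OF W' Wc i, of 0] by (simp add: sum_distrib_left del: sum.lessThan_Suc index_mult_mat(1))
    also have "\<dots> = (if i = 0 then e else 0)" unfolding unitary_matD(2)[OF W] using i by simp
    finally show ?thesis .
  qed
  define M3 where "M3 = Matrix.mat m m (\<lambda>(i, j). M $$ (Suc i, Suc j))"
  have M3: "M3 \<in> carrier_mat m m" unfolding M3_def by simp
  have hM3: "hermitian_mat m M3"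
    unfolding hermitian_mat_def using M3 hermitian_matD[OF hM] by (auto simp: M3_def)
  obtain P l where P: "unitary_mat m P"
    and l: "mat_adjoint P * M3 * P = Matrix.mat m m (\<lambda>(i, j). if i = j then complex_of_real (l i) else 0)"
    using Suc.IH[OF hM3] by blast
  note Pc = unitary_matD(1)[OF P]
  note P' = mat_adjoint_carrier[OF Pc]
  \<comment> \<open>Block-diagonal matrices with corner x; \<open>?blk 1 P\<close> lifts the unitary
    of the induction hypothesis to the larger size.\<close>
  let ?blk = "\<lambda>x X. four_block_mat (Matrix.mat 1 1 (\<lambda>_. x)) (0\<^sub>m 1 m) (0\<^sub>m m 1) X :: complex mat"
  have blk_mult: "?blk x X * ?blk y Y = ?blk (x * y) (X * Y)"
    if "X \<in> carrier_mat m m" "Y \<in> carrier_mat m m" for x y X Y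
  proof -
    have "Matrix.mat 1 1 (\<lambda>_. x) * Matrix.mat 1 1 (\<lambda>_. y) = Matrix.mat 1 1 (\<lambda>_. x * y)" for x y :: complex
      by (rule eq_matI) (auto simp: scalar_prod_def)
    then show ?thesis
      using that by (subst mult_four_block_mat[where ?nr1.0 = 1 and ?n1.0 = 1 and ?n2.0 = m and ?nr2.0 = m and ?nc1.0 = 1 and ?nc2.0 = m]) auto
  qed
  have M_blk: "M = ?blk e M3"
  proof (rule eq_matI)
    fix i j assume "i < dim_row (?blk e M3)" "j < dim_col (?blk e M3)"
    then have ij: "i < ?n" "j < ?n" using M3 by auto
    show "M $$ (i, j) = ?blk e M3 $$ (i, j)"
    proof (cases "j = 0")
      case True
      then show ?thesis using M0[OF ij(1)] M3 ij by auto
    next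
      case False
      have "M $$ (0, j) = 0" using False M0[OF ij(2)] hermitian_matD[OF hM ij(2), of 0] by auto
      then show ?thesis using M3 ij False by (auto simp: M3_def)
    qed
  qed (use M M3 in auto)
  \<comment> \<open>As a diagonal entry of the Hermitian \<open>M\<close>, the eigenvalue e is real,
    which the claimed real diagonal requires.\<close>
  have e: "complex_of_real (Re e) = e"
    using hermitian_diag_entry_real[OF hM, of 0] M0[of 0] by (metis zero_less_Suc)
  have Bc: "?blk 1 P \<in> carrier_mat ?n ?n"
    using four_block_carrier_mat[of "Matrix.mat 1 1 (\<lambda>_. 1)" 1 1 P m m] Pc by simp
  have adj_blk: "mat_adjoint (?blk 1 P) = ?blk 1 (mat_adjoint P)"
  proof (rule eq_matI)
    show "dim_row (mat_adjoint (?blk 1 P)) = dim_row (?blk 1 (mat_adjoint P))"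
      "dim_col (mat_adjoint (?blk 1 P)) = dim_col (?blk 1 (mat_adjoint P))"
      using Bc P' by auto
    fix i j assume "i < dim_row (?blk 1 (mat_adjoint P))" "j < dim_col (?blk 1 (mat_adjoint P))"
    then have ij: "i < ?n" "j < ?n" using P' by auto
    show "mat_adjoint (?blk 1 P) $$ (i, j) = ?blk 1 (mat_adjoint P) $$ (i, j)"
      unfolding mat_adjoint_index[OF Bc ij]
      using ij Pc P' by (auto simp: mat_adjoint_index[OF Pc])
  qed
  note B' = mat_adjoint_carrier[OF Bc]
  have uB: "unitary_mat ?n (?blk 1 P)"
  proof -
    have "?blk 1 (1\<^sub>m m) = 1\<^sub>m ?n" by (rule eq_matI) auto
    then show ?thesis
      unfolding unitary_mat_def adj_blk blk_mult[OF P' Pc] unitary_matD(2)[OF P]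
      using Bc by simp
  qed
  let ?D = "\<lambda>n l. Matrix.mat n n (\<lambda>(i, j). if i = j then complex_of_real (l i) else 0)"
  have "mat_adjoint (W * ?blk 1 P) * A * (W * ?blk 1 P) = mat_adjoint (?blk 1 P) * M * ?blk 1 P"
  proof -
    have "mat_adjoint (W * ?blk 1 P) * A * (W * ?blk 1 P)
        = mat_adjoint (?blk 1 P) * mat_adjoint W * A * (W * ?blk 1 P)"
      unfolding mat_adjoint_mult[OF Wc Bc] ..
    also have "\<dots> = mat_adjoint (?blk 1 P) * mat_adjoint W * A * W * ?blk 1 P"
      by (rule assoc_mult_mat[symmetric, OF mult_carrier_mat[OF mult_carrier_mat[OF B' W'] A] Wc Bc])
    also have "mat_adjoint (?blk 1 P) * mat_adjoint W * A = mat_adjoint (?blk 1 P) * (mat_adjoint W * A)"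
      by (rule assoc_mult_mat[OF B' W' A])
    also have "\<dots> * W = mat_adjoint (?blk 1 P) * M"
      unfolding M_def by (rule assoc_mult_mat[OF B' mult_carrier_mat[OF W' A] Wc])
    finally show ?thesis .
  qed
  also have "\<dots> = ?blk e (mat_adjoint P * M3 * P)"
    unfolding M_blk adj_blk blk_mult[OF P' M3] blk_mult[OF mult_carrier_mat[OF P' M3] Pc] by simp
  also have "\<dots> = ?D ?n (\<lambda>i. if i = 0 then Re e else l (i - 1))"
    unfolding l using e by (intro eq_matI) auto
  finally show ?case
    using unitary_mat_mult[OF W uB] by (intro exI conjI)
qed

section \<open>Monotonicity and perturbation of eigenvalues\<close>

lemma proots_linear_factors: "proots (\<Prod>a\<leftarrow>xs. [:- a, 1:]) = mset (xs :: complex list)"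
proof (induction xs)
  case (Cons a xs)
  have "(\<Prod>a\<leftarrow>xs. [:- a, 1:]) \<noteq> 0" by (auto simp: prod_list_zero_iff)
  then have "proots ([:- a, 1:] * (\<Prod>a\<leftarrow>xs. [:- a, 1:])) = proots [:- a, 1:] + proots (\<Prod>a\<leftarrow>xs. [:- a, 1:])"
    by (intro proots_mult) auto
  then show ?case using Cons by simp
qed simp

lemma sorted_eigenvalues_sorted: "sorted (sorted_eigenvalues A)"
  unfolding sorted_eigenvalues_def by simp

lemma sorted_eigenvalues_similar: "similar_mat A B \<Longrightarrow> sorted_eigenvalues A = sorted_eigenvalues B"
  unfolding sorted_eigenvalues_def by (simp add: char_poly_similar)

text \<open>\<open>u k\<close> is a unit eigenvector for the k-th smallest eigenvalue (k from 0),
  and \<open>u k i\<close> its i-th coordinate. The clauses are orthonormality, completeness and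
  spectral decomposition; tying the numbering to the sorted list is what the variational argument
  below needs.\<close>

definition eigenbasis :: "nat \<Rightarrow> complex mat \<Rightarrow> (nat \<Rightarrow> nat \<Rightarrow> complex) \<Rightarrow> bool" where
  "eigenbasis n A u \<longleftrightarrow>
    (\<forall>k<n. \<forall>l<n. (\<Sum>i<n. cnj (u k i) * u l i) = (if k = l then 1 else 0)) \<and>
    (\<forall>i<n. \<forall>j<n. (\<Sum>k<n. u k i * cnj (u k j)) = (if i = j then 1 else 0)) \<and>
    (\<forall>i<n. \<forall>j<n. A $$ (i, j)
       = (\<Sum>k<n. complex_of_real (sorted_eigenvalues A ! k) * (u k i * cnj (u k j))))"

lemma eigenbasisD:
  assumes "eigenbasis n A u" "i < n" "j < n"
  shows "(\<Sum>k<n. cnj (u i k) * u j k) = (if i = j then 1 else 0)"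
    and "(\<Sum>k<n. u k i * cnj (u k j)) = (if i = j then 1 else 0)"
    and "A $$ (i, j) = (\<Sum>k<n. complex_of_real (sorted_eigenvalues A ! k) * (u k i * cnj (u k j)))"
  using assms unfolding eigenbasis_def by blast+

lemma hermitian_eigenbasis:
  assumes h: "hermitian_mat n A"
  shows "length (sorted_eigenvalues A) = n \<and> (\<exists>u. eigenbasis n A u)"
proof -
  note A = hermitian_mat_carrier[OF h]
  obtain U and l :: "nat \<Rightarrow> real" where U: "unitary_mat n U"
    and l: "mat_adjoint U * A * U = Matrix.mat n n (\<lambda>(i, j). if i = j then complex_of_real (l i) else 0)"
    using hermitian_spectral[OF h] by blast
  define D where "D = Matrix.mat n n (\<lambda>(i, j). if i = j then complex_of_real (l i) else 0)"
  have D: "D \<in> carrier_mat n n" unfolding D_def by simp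
  note Uc = unitary_matD(1)[OF U]
  note U' = mat_adjoint_carrier[OF Uc]
  have AU: "A = U * D * mat_adjoint U"
  proof -
    have "U * D * mat_adjoint U = U * (mat_adjoint U * (A * U)) * mat_adjoint U"
      unfolding D_def l[symmetric] assoc_mult_mat[OF U' A Uc] ..
    also have "U * (mat_adjoint U * (A * U)) = A * U"
      unfolding assoc_mult_mat[OF Uc U' mult_carrier_mat[OF A Uc], symmetric] unitary_matD(3)[OF U]
      by (rule left_mult_one_mat[OF mult_carrier_mat[OF A Uc]])
    also have "A * U * mat_adjoint U = A"
      unfolding assoc_mult_mat[OF A Uc U'] unitary_matD(3)[OF U] by (rule right_mult_one_mat[OF A])
    finally show ?thesis ..
  qed
  have "similar_mat A D"
    unfolding similar_mat_def similar_mat_wit_def Let_def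
    using A D Uc U' unitary_matD[OF U] AU by (intro exI[of _ U] exI[of _ "mat_adjoint U"]) auto
  then have "char_poly A = char_poly D" by (rule char_poly_similar)
  also have "\<dots> = (\<Prod>a\<leftarrow>diag_mat D. [:- a, 1:])"
    by (rule char_poly_upper_triangular[OF D]) (auto simp: D_def upper_triangular_def)
  also have "diag_mat D = map (\<lambda>i. complex_of_real (l i)) [0..<n]"
    by (auto simp: diag_mat_def D_def)
  finally have "proots (char_poly A) = mset (map (\<lambda>i. complex_of_real (l i)) [0..<n])"
    by (simp only: proots_linear_factors)
  then have eigs: "sorted_eigenvalues A = sort (map l [0..<n])"
    unfolding sorted_eigenvalues_def
    by (simp add: image_mset.compositionality comp_def flip: mset_map)
  have len: "length (sorted_eigenvalues A) = n" unfolding eigs by simp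
  \<comment> \<open>The diagonalisation lists the eigenvalues in arbitrary order; p matches its
    columns with the sorted list.\<close>
  obtain p where p: "p permutes {..<n}" and pl: "permute_list p (map l [0..<n]) = sorted_eigenvalues A"
    using mset_eq_permutation[of "sorted_eigenvalues A" "map l [0..<n]"] unfolding eigs by auto
  have pn: "p k < n \<longleftrightarrow> k < n" for k using permutes_in_image[OF p] by auto
  have eig_nth: "sorted_eigenvalues A ! k = l (p k)" if "k < n" for k
    using that pn unfolding pl[symmetric] by (simp add: permute_list_def)
  have reindex: "(\<Sum>k<n. f (p k)) = (\<Sum>k<n. f k)" for f :: "nat \<Rightarrow> complex"
    using sum.permute[OF p, of f] by (simp add: comp_def)
  define u where "u k i = U $$ (i, p k)" for k i
  have "eigenbasis n A u"
    unfolding eigenbasis_def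
  proof (intro conjI allI impI)
    fix k m assume km: "k < n" "m < n"
    have "(\<Sum>i<n. cnj (u k i) * u m i) = (mat_adjoint U * U) $$ (p k, p m)"
      unfolding u_def using km pn
      by (simp add: index_mult_mat_sum[OF U' Uc] mat_adjoint_index[OF Uc] del: index_mult_mat(1))
    also have "\<dots> = (if k = m then 1 else 0)"
      unfolding unitary_matD(2)[OF U] using km pn permutes_inj[OF p] by (auto dest: injD)
    finally show "(\<Sum>i<n. cnj (u k i) * u m i) = (if k = m then 1 else 0)" .
  next
    fix i j assume ij: "i < n" "j < n"
    have "(\<Sum>k<n. u k i * cnj (u k j)) = (\<Sum>k<n. U $$ (i, k) * cnj (U $$ (j, k)))"
      unfolding u_def by (rule reindex[of "\<lambda>k. U $$ (i, k) * cnj (U $$ (j, k))"])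
    also have "\<dots> = (U * mat_adjoint U) $$ (i, j)"
      using ij by (simp add: index_mult_mat_sum[OF Uc U'] mat_adjoint_index[OF Uc] del: index_mult_mat(1))
    finally show "(\<Sum>k<n. u k i * cnj (u k j)) = (if i = j then 1 else 0)"
      unfolding unitary_matD(3)[OF U] using ij by simp
  next
    fix i j assume ij: "i < n" "j < n"
    have "A $$ (i, j) = (\<Sum>k<n. (U * D) $$ (i, k) * mat_adjoint U $$ (k, j))"
      by (subst AU) (rule index_mult_mat_sum[OF mult_carrier_mat[OF Uc D] U' ij])
    also have "\<dots> = (\<Sum>k<n. complex_of_real (l k) * (U $$ (i, k) * cnj (U $$ (j, k))))"
    proof (intro sum.cong refl)
      fix k assume "k \<in> {..<n}"
      then have k: "k < n" by simp
      have "(U * D) $$ (i, k) = (\<Sum>m<n. U $$ (i, m) * D $$ (m, k))"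
        by (rule index_mult_mat_sum[OF Uc D ij(1) k])
      also have "\<dots> = (\<Sum>m<n. if m = k then U $$ (i, m) * complex_of_real (l k) else 0)"
        using k by (intro sum.cong refl) (auto simp: D_def)
      also have "\<dots> = U $$ (i, k) * complex_of_real (l k)" using k by simp
      finally show "(U * D) $$ (i, k) * mat_adjoint U $$ (k, j)
          = complex_of_real (l k) * (U $$ (i, k) * cnj (U $$ (j, k)))"
        using mat_adjoint_index[OF Uc k ij(2)] by simp
    qed
    also have "\<dots> = (\<Sum>k<n. complex_of_real (l (p k)) * (u k i * cnj (u k j)))"
      unfolding u_def by (rule reindex[of "\<lambda>k. complex_of_real (l k) * (U $$ (i, k) * cnj (U $$ (j, k)))", symmetric])
    also have "\<dots> = (\<Sum>k<n. complex_of_real (sorted_eigenvalues A ! k) * (u k i * cnj (u k j)))"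
      by (intro sum.cong refl) (simp add: eig_nth)
    finally show "A $$ (i, j) = (\<Sum>k<n. complex_of_real (sorted_eigenvalues A ! k) * (u k i * cnj (u k j)))" .
  qed
  with len show ?thesis by blast
qed

lemma length_sorted_eigenvalues: "hermitian_mat n A \<Longrightarrow> length (sorted_eigenvalues A) = n"
  using hermitian_eigenbasis by blast

section \<open>Trace and quadratic form in an eigenbasis\<close>

lemma hermitian_trace:
  assumes "hermitian_mat n A"
  shows "(\<Sum>i<n. Re (A $$ (i, i))) = (\<Sum>k<n. sorted_eigenvalues A ! k)"
proof -
  obtain u where u: "eigenbasis n A u"
    using hermitian_eigenbasis[OF assms] by blast
  have "(\<Sum>i<n. A $$ (i, i)) = (\<Sum>i<n. \<Sum>k<n. complex_of_real (sorted_eigenvalues A ! k) * (cnj (u k i) * u k i))"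
    by (intro sum.cong refl) (simp only: eigenbasisD(3)[OF u] lessThan_iff mult.commute)
  also have "\<dots> = (\<Sum>k<n. complex_of_real (sorted_eigenvalues A ! k) * (\<Sum>i<n. cnj (u k i) * u k i))"
    unfolding sum_distrib_left by (rule sum.swap)
  also have "\<dots> = complex_of_real (\<Sum>k<n. sorted_eigenvalues A ! k)"
    unfolding of_real_sum by (intro sum.cong refl) (simp only: eigenbasisD(1)[OF u] lessThan_iff simp_thms if_True mult_1_right)
  finally have "Re (\<Sum>i<n. A $$ (i, i)) = (\<Sum>k<n. sorted_eigenvalues A ! k)" by simp
  then show ?thesis by simp
qed

text \<open>The form x^* A x. It is real for Hermitian A; taking the real part makes forms
  comparable by \<le>.\<close>

definition qform :: "nat \<Rightarrow> complex mat \<Rightarrow> (nat \<Rightarrow> complex) \<Rightarrow> real" where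
  "qform n A x = Re (\<Sum>i<n. \<Sum>j<n. cnj (x i) * A $$ (i, j) * x j)"

text \<open>One computation for two uses: with l the eigenvalues it diagonalises the form, and with
  l = 1 completeness turns the left side into the squared norm (Parseval).\<close>

lemma rank_one_sum_form:
  fixes u :: "nat \<Rightarrow> nat \<Rightarrow> complex"
  shows "Re (\<Sum>i<n. \<Sum>j<n. cnj (x i) * (\<Sum>k<n. complex_of_real (l k) * (u k i * cnj (u k j))) * x j)
    = (\<Sum>k<n. l k * (cmod (\<Sum>j<n. cnj (u k j) * x j))\<^sup>2)"
proof -
  have "(\<Sum>i<n. \<Sum>j<n. cnj (x i) * (\<Sum>k<n. complex_of_real (l k) * (u k i * cnj (u k j))) * x j)
    = (\<Sum>i<n. \<Sum>j<n. \<Sum>k<n. complex_of_real (l k) * ((cnj (x i) * u k i) * (cnj (u k j) * x j)))"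
    unfolding sum_distrib_left sum_distrib_right by (intro sum.cong refl) (simp add: mult_ac)
  also have "\<dots> = (\<Sum>i<n. \<Sum>k<n. \<Sum>j<n. complex_of_real (l k) * ((cnj (x i) * u k i) * (cnj (u k j) * x j)))"
    by (rule sum.cong[OF refl], rule sum.swap)
  also have "\<dots> = (\<Sum>k<n. \<Sum>i<n. \<Sum>j<n. complex_of_real (l k) * ((cnj (x i) * u k i) * (cnj (u k j) * x j)))"
    by (rule sum.swap)
  also have "\<dots> = (\<Sum>k<n. complex_of_real (l k) * ((\<Sum>i<n. cnj (x i) * u k i) * (\<Sum>j<n. cnj (u k j) * x j)))"
    unfolding sum_product by (simp only: sum_distrib_left)
  also have "\<dots> = (\<Sum>k<n. complex_of_real (l k * (cmod (\<Sum>j<n. cnj (u k j) * x j))\<^sup>2))"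
  proof (intro sum.cong refl)
    fix k
    have "(\<Sum>i<n. cnj (x i) * u k i) = cnj (\<Sum>j<n. cnj (u k j) * x j)"
      by (simp add: mult.commute)
    then show "complex_of_real (l k) * ((\<Sum>i<n. cnj (x i) * u k i) * (\<Sum>j<n. cnj (u k j) * x j))
        = complex_of_real (l k * (cmod (\<Sum>j<n. cnj (u k j) * x j))\<^sup>2)"
      unfolding of_real_mult complex_norm_square by (simp only: mult.commute)
  qed
  finally show ?thesis by (simp only: of_real_sum[symmetric] Re_complex_of_real)
qed

lemma qform_eigenbasis:
  assumes u: "eigenbasis n A u"
  shows "qform n A x = (\<Sum>k<n. sorted_eigenvalues A ! k * (cmod (\<Sum>j<n. cnj (u k j) * x j))\<^sup>2)"
proof -
  have "qform n A x = Re (\<Sum>i<n. \<Sum>j<n. cnj (x i) *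
      (\<Sum>k<n. complex_of_real (sorted_eigenvalues A ! k) * (u k i * cnj (u k j))) * x j)"
    unfolding qform_def
    by (intro arg_cong[of _ _ Re] sum.cong refl) (simp only: eigenbasisD(3)[OF u] lessThan_iff)
  then show ?thesis unfolding rank_one_sum_form .
qed

lemma eigenbasis_parseval:
  assumes u: "eigenbasis n A u"
  shows "(\<Sum>i<n. (cmod (x i))\<^sup>2) = (\<Sum>k<n. (cmod (\<Sum>j<n. cnj (u k j) * x j))\<^sup>2)"
proof -
  have "(\<Sum>i<n. \<Sum>j<n. cnj (x i) * (\<Sum>k<n. complex_of_real 1 * (u k i * cnj (u k j))) * x j)
    = (\<Sum>i<n. \<Sum>j<n. if i = j then cnj (x i) * x i else 0)"
    by (intro sum.cong refl) (simp add: eigenbasisD(2)[OF u])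
  also have "\<dots> = (\<Sum>i<n. complex_of_real ((cmod (x i))\<^sup>2))"
    by (intro sum.cong refl) (simp add: complex_norm_square mult.commute del: of_real_power)
  finally have "Re (\<Sum>i<n. \<Sum>j<n. cnj (x i) * (\<Sum>k<n. complex_of_real 1 * (u k i * cnj (u k j))) * x j)
    = (\<Sum>i<n. (cmod (x i))\<^sup>2)"
    by (simp only: of_real_sum[symmetric] Re_complex_of_real)
  then show ?thesis unfolding rank_one_sum_form by simp
qed

text \<open>There are i equations in i + 1 unknowns. An added zero row makes the system square and
  its matrix singular.\<close>

lemma homogeneous_system_nontrivial:
  fixes M :: "nat \<Rightarrow> nat \<Rightarrow> complex"
  obtains c where "\<exists>l\<le>i. c l \<noteq> 0" "\<And>k. k < i \<Longrightarrow> (\<Sum>l\<le>i. M k l * c l) = 0"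
proof -
  define N where "N = Matrix.mat (Suc i) (Suc i) (\<lambda>(k, l). if k < i then M k l else 0)"
  have N: "N \<in> carrier_mat (Suc i) (Suc i)" unfolding N_def by simp
  \<comment> \<open>The padding row has index i, so the i-th unit vector lies in the kernel of the
    transpose.\<close>
  have "transpose_mat N *\<^sub>v unit_vec (Suc i) i = 0\<^sub>v (Suc i)"
  proof (rule eq_vecI)
    fix j assume j: "j < dim_vec (0\<^sub>v (Suc i) :: complex vec)"
    have "vec_index (transpose_mat N *\<^sub>v unit_vec (Suc i) i) j = scalar_prod (col N j) (unit_vec (Suc i) i)"
      using N j by simp
    also have "\<dots> = vec_index (col N j) i"
      by (rule scalar_prod_right_unit) (use N in auto)
    also have "\<dots> = 0" using j by (simp add: N_def)
    finally show "vec_index (transpose_mat N *\<^sub>v unit_vec (Suc i) i) j = vec_index (0\<^sub>v (Suc i)) j"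
      using j by simp
  qed (use N in simp)
  then have "Determinant.det (transpose_mat N) = 0"
    using det_0_iff_vec_prod_zero_field[of "transpose_mat N" "Suc i"] N unit_vec_nonzero[of i "Suc i"]
    by (metis lessI transpose_carrier_mat unit_vec_carrier)
  then have "Determinant.det N = 0" using det_transpose[OF N] by simp
  then obtain v where v: "v \<in> carrier_vec (Suc i)" "v \<noteq> 0\<^sub>v (Suc i)" "N *\<^sub>v v = 0\<^sub>v (Suc i)"
    using det_0_iff_vec_prod_zero_field[OF N] by auto
  show thesis
  proof (rule that[of "vec_index v"])
    show "\<exists>l\<le>i. vec_index v l \<noteq> 0"
    proof (rule ccontr)
      assume "\<not> ?thesis"
      then have "v = 0\<^sub>v (Suc i)" using v(1) by (intro eq_vecI) auto
      then show False using v(2) by simp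
    qed
    fix k assume k: "k < i"
    have "(\<Sum>l\<le>i. M k l * vec_index v l) = vec_index (N *\<^sub>v v) k"
      using k v(1) unfolding N_def
      by (auto simp: scalar_prod_def atLeast0LessThan lessThan_Suc_atMost intro!: sum.cong)
    then show "(\<Sum>l\<le>i. M k l * vec_index v l) = 0" unfolding v(3) using k by simp
  qed
qed

text \<open>Courant-Fischer by a dimension count. The span of the lowest i + 1 eigenvectors of B
  contains a nonzero x orthogonal to the lowest i eigenvectors of A. At x the form of A is at least
  its i-th eigenvalue times |x|^2, and that of B at most its i-th eigenvalue times |x|^2.\<close>

theorem sorted_eigenvalues_mono:
  assumes hA: "hermitian_mat n A" and hB: "hermitian_mat n B"
    and le: "\<And>x. qform n A x \<le> qform n B x" and i: "i < n"
  shows "sorted_eigenvalues A ! i \<le> sorted_eigenvalues B ! i"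
proof -
  obtain u where u: "eigenbasis n A u"
    using hermitian_eigenbasis[OF hA] by blast
  obtain w where w: "eigenbasis n B w"
    using hermitian_eigenbasis[OF hB] by blast
  obtain c where c: "\<exists>l\<le>i. c l \<noteq> 0"
    "\<And>k. k < i \<Longrightarrow> (\<Sum>l\<le>i. (\<Sum>j<n. cnj (u k j) * w l j) * c l) = 0"
    using homogeneous_system_nontrivial[of i "\<lambda>k l. \<Sum>j<n. cnj (u k j) * w l j"] by metis
  define x where "x j = (\<Sum>l\<le>i. c l * w l j)" for j
  have coord: "(\<Sum>j<n. cnj (f j) * x j) = (\<Sum>l\<le>i. (\<Sum>j<n. cnj (f j) * w l j) * c l)" for f
    unfolding x_def sum_distrib_left sum_distrib_right by (subst sum.swap) (simp add: mult_ac)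
  \<comment> \<open>y and z are the coordinates of x in the eigenbases of A and B: y vanishes below
    i, z above i.\<close>
  define y where "y k = (\<Sum>j<n. cnj (u k j) * x j)" for k
  define z where "z k = (\<Sum>j<n. cnj (w k j) * x j)" for k
  have y0: "y k = 0" if "k < i" for k
    unfolding y_def coord using c(2)[OF that] .
  have z: "z k = (if k \<le> i then c k else 0)" if "k < n" for k
  proof -
    have "z k = (\<Sum>l\<le>i. (if k = l then 1 else 0) * c l)"
      unfolding z_def coord by (intro sum.cong refl) (use i that eigenbasisD(1)[OF w] in auto)
    also have "\<dots> = (\<Sum>l\<le>i. if k = l then c l else 0)" by (intro sum.cong refl) auto
    also have "\<dots> = (if k \<le> i then c k else 0)" by simp
    finally show ?thesis .
  qed
  let ?N = "\<Sum>i<n. (cmod (x i))\<^sup>2"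
  let ?l = "\<lambda>k. sorted_eigenvalues A ! k" and ?m = "\<lambda>k. sorted_eigenvalues B ! k"
  have Ny: "?N = (\<Sum>k<n. (cmod (y k))\<^sup>2)" unfolding y_def by (rule eigenbasis_parseval[OF u])
  have Nz: "?N = (\<Sum>k<n. (cmod (z k))\<^sup>2)" unfolding z_def by (rule eigenbasis_parseval[OF w])
  have qA: "qform n A x = (\<Sum>k<n. ?l k * (cmod (y k))\<^sup>2)"
    unfolding y_def by (rule qform_eigenbasis[OF u])
  have qB: "qform n B x = (\<Sum>k<n. ?m k * (cmod (z k))\<^sup>2)"
    unfolding z_def by (rule qform_eigenbasis[OF w])
  have "?N > 0"
  proof -
    obtain l where l: "l \<le> i" "c l \<noteq> 0" using c(1) by blast
    have "0 < (cmod (z l))\<^sup>2" using z[of l] l i by auto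
    also have "\<dots> \<le> (\<Sum>k<n. (cmod (z k))\<^sup>2)"
      by (rule member_le_sum) (use l i in auto)
    finally show ?thesis unfolding Nz .
  qed
  have "?l i * ?N = (\<Sum>k<n. ?l i * (cmod (y k))\<^sup>2)" unfolding Ny sum_distrib_left ..
  also have "\<dots> \<le> (\<Sum>k<n. ?l k * (cmod (y k))\<^sup>2)"
  proof (rule sum_mono)
    fix k assume "k \<in> {..<n}"
    then have "k < i \<or> ?l i \<le> ?l k"
      using sorted_nth_mono[OF sorted_eigenvalues_sorted, of i k A] length_sorted_eigenvalues[OF hA] by force
    then show "?l i * (cmod (y k))\<^sup>2 \<le> ?l k * (cmod (y k))\<^sup>2"
      using y0 by (auto intro: mult_right_mono)
  qed
  also have "\<dots> \<le> (\<Sum>k<n. ?m k * (cmod (z k))\<^sup>2)" using le[of x] unfolding qA qB .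
  also have "\<dots> \<le> (\<Sum>k<n. ?m i * (cmod (z k))\<^sup>2)"
  proof (rule sum_mono)
    fix k assume "k \<in> {..<n}"
    then have "z k = 0 \<or> ?m k \<le> ?m i"
      using sorted_nth_mono[OF sorted_eigenvalues_sorted, of k i B] length_sorted_eigenvalues[OF hB] z[of k] i by force
    then show "?m k * (cmod (z k))\<^sup>2 \<le> ?m i * (cmod (z k))\<^sup>2"
      by (auto intro: mult_right_mono)
  qed
  also have "\<dots> = ?m i * ?N" unfolding Nz sum_distrib_left ..
  finally show ?thesis using \<open>?N > 0\<close> by simp
qed

section \<open>Diagonal shifts and the sum of eigenvalue differences\<close>

lemma qform_add_diag:
  assumes "B \<in> carrier_mat n n"
  shows "qform n (Matrix.mat n n (\<lambda>(i, j). B $$ (i, j) + (if i = j then complex_of_real (r i) else 0))) x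
    = qform n B x + (\<Sum>i<n. r i * (cmod (x i))\<^sup>2)"
proof -
  have "(\<Sum>i<n. \<Sum>j<n. cnj (x i) * Matrix.mat n n (\<lambda>(i, j). B $$ (i, j) + (if i = j then complex_of_real (r i) else 0)) $$ (i, j) * x j)
    = (\<Sum>i<n. (\<Sum>j<n. cnj (x i) * B $$ (i, j) * x j) + (\<Sum>j<n. if i = j then complex_of_real (r i) * (cnj (x i) * x i) else 0))"
    unfolding sum.distrib[symmetric] by (intro sum.cong refl) (auto simp: algebra_simps)
  also have "\<dots> = (\<Sum>i<n. \<Sum>j<n. cnj (x i) * B $$ (i, j) * x j) + complex_of_real (\<Sum>i<n. r i * (cmod (x i))\<^sup>2)"
    unfolding sum.distrib of_real_sum of_real_mult complex_norm_square
    by (intro arg_cong2[of _ _ _ _ "(+)"] sum.cong refl) (simp add: mult.commute)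
  finally show ?thesis unfolding qform_def by simp
qed

text \<open>Each term of the form of V = A - B is split by 2ab \<le> a^2 + b^2. Since |V_ji| =
  |V_ij|, the half weighted by |x_j|^2 equals the half weighted by |x_i|^2, and only row sums
  remain.\<close>

lemma qform_diff_le_row_sums:
  assumes hA: "hermitian_mat n A" and hB: "hermitian_mat n B"
  shows "\<bar>qform n A x - qform n B x\<bar> \<le> (\<Sum>i<n. (\<Sum>j<n. cmod (A $$ (i, j) - B $$ (i, j))) * (cmod (x i))\<^sup>2)"
proof -
  let ?V = "\<lambda>i j. A $$ (i, j) - B $$ (i, j)"
  have sym: "cmod (?V j i) = cmod (?V i j)" if "i < n" "j < n" for i j
  proof -
    have "?V j i = cnj (?V i j)"
      using hermitian_matD[OF hA that] hermitian_matD[OF hB that] by simp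
    then show ?thesis by (metis complex_mod_cnj)
  qed
  have "qform n A x - qform n B x = Re (\<Sum>i<n. \<Sum>j<n. cnj (x i) * ?V i j * x j)"
    unfolding qform_def minus_complex.sel(1)[symmetric] sum_subtractf[symmetric]
    by (intro arg_cong[of _ _ Re] sum.cong refl) (simp add: algebra_simps)
  then have "\<bar>qform n A x - qform n B x\<bar> \<le> cmod (\<Sum>i<n. \<Sum>j<n. cnj (x i) * ?V i j * x j)"
    by (simp only: abs_Re_le_cmod)
  also have "\<dots> \<le> (\<Sum>i<n. \<Sum>j<n. cmod (cnj (x i) * ?V i j * x j))"
    by (intro order_trans[OF norm_sum] sum_mono norm_sum)
  also have "\<dots> \<le> (\<Sum>i<n. \<Sum>j<n. cmod (?V i j) * (cmod (x i))\<^sup>2 / 2 + cmod (?V i j) * (cmod (x j))\<^sup>2 / 2)"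
  proof (intro sum_mono)
    fix i j
    have "2 * (cmod (x i) * cmod (x j)) \<le> (cmod (x i))\<^sup>2 + (cmod (x j))\<^sup>2"
      using sum_squares_bound[of "cmod (x i)" "cmod (x j)"] by (simp add: mult.assoc)
    then have "cmod (?V i j) * (2 * (cmod (x i) * cmod (x j))) \<le> cmod (?V i j) * ((cmod (x i))\<^sup>2 + (cmod (x j))\<^sup>2)"
      by (rule mult_left_mono) simp
    moreover have "cmod (cnj (x i) * ?V i j * x j) = cmod (?V i j) * (cmod (x i) * cmod (x j))"
      by (simp only: norm_mult complex_mod_cnj mult_ac)
    ultimately show "cmod (cnj (x i) * ?V i j * x j) \<le> cmod (?V i j) * (cmod (x i))\<^sup>2 / 2 + cmod (?V i j) * (cmod (x j))\<^sup>2 / 2"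
      unfolding distrib_left by linarith
  qed
  also have "\<dots> = (\<Sum>i<n. \<Sum>j<n. cmod (?V i j) * (cmod (x i))\<^sup>2 / 2) + (\<Sum>i<n. \<Sum>j<n. cmod (?V i j) * (cmod (x j))\<^sup>2 / 2)"
    unfolding sum.distrib ..
  also have "(\<Sum>i<n. \<Sum>j<n. cmod (?V i j) * (cmod (x j))\<^sup>2 / 2) = (\<Sum>i<n. \<Sum>j<n. cmod (?V i j) * (cmod (x i))\<^sup>2 / 2)"
    by (subst sum.swap) (intro sum.cong refl, simp add: sym)
  also have "(\<Sum>i<n. \<Sum>j<n. cmod (?V i j) * (cmod (x i))\<^sup>2 / 2) + (\<Sum>i<n. \<Sum>j<n. cmod (?V i j) * (cmod (x i))\<^sup>2 / 2)
      = (\<Sum>i<n. (\<Sum>j<n. cmod (?V i j)) * (cmod (x i))\<^sup>2)"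
    unfolding sum.distrib[symmetric] sum_distrib_right by (intro sum.cong refl) simp
  finally show ?thesis .
qed

lemma hermitian_add_diag:
  assumes "hermitian_mat n B"
  shows "hermitian_mat n (Matrix.mat n n (\<lambda>(i, j). B $$ (i, j) + (if i = j then complex_of_real (r i) else 0)))"
  unfolding hermitian_mat_def using hermitian_matD[OF assms] by auto

theorem sum_sorted_eigenvalues_diff_le:
  assumes hA: "hermitian_mat n A" and hB: "hermitian_mat n B"
  shows "(\<Sum>i<n. \<bar>sorted_eigenvalues A ! i - sorted_eigenvalues B ! i\<bar>) \<le> 2 * entry_norm1 (A - B)"
proof -
  define r where "r i = (\<Sum>j<n. cmod (A $$ (i, j) - B $$ (i, j)))" for i
  \<comment> \<open>\<open>S 1\<close> and \<open>S (-1)\<close> are B + D and B - D; the parameter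
    s treats both at once.\<close>
  define S where "S s = Matrix.mat n n (\<lambda>(i, j). B $$ (i, j) + (if i = j then complex_of_real (s * r i) else 0))" for s
  note A = hermitian_mat_carrier[OF hA] and B = hermitian_mat_carrier[OF hB]
  have hS: "hermitian_mat n (S s)" for s
    unfolding S_def using hermitian_add_diag[OF hB, of "\<lambda>i. s * r i"] .
  have qS: "qform n (S s) x = qform n B x + s * (\<Sum>i<n. r i * (cmod (x i))\<^sup>2)" for s x
    unfolding S_def qform_add_diag[OF B, of "\<lambda>i. s * r i"] sum_distrib_left by (simp add: mult.assoc)
  have r0: "r i \<ge> 0" for i unfolding r_def by (intro sum_nonneg) auto
  have R0: "(\<Sum>i<n. r i * (cmod (x i))\<^sup>2) \<ge> 0" for x using r0 by (intro sum_nonneg) auto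
  have AB: "\<bar>qform n A x - qform n B x\<bar> \<le> (\<Sum>i<n. r i * (cmod (x i))\<^sup>2)" for x
    unfolding r_def by (rule qform_diff_le_row_sums[OF hA hB])
  have "(\<Sum>i<n. \<bar>sorted_eigenvalues A ! i - sorted_eigenvalues B ! i\<bar>)
      \<le> (\<Sum>i<n. sorted_eigenvalues (S 1) ! i - sorted_eigenvalues (S (-1)) ! i)"
  proof (rule sum_mono)
    fix i assume "i \<in> {..<n}"
    then have i: "i < n" by simp
    have "sorted_eigenvalues A ! i \<le> sorted_eigenvalues (S 1) ! i"
      by (rule sorted_eigenvalues_mono[OF hA hS _ i]) (use AB in \<open>auto simp: qS abs_le_iff algebra_simps\<close>)
    moreover have "sorted_eigenvalues B ! i \<le> sorted_eigenvalues (S 1) ! i"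
      by (rule sorted_eigenvalues_mono[OF hB hS _ i]) (use R0 in \<open>auto simp: qS\<close>)
    moreover have "sorted_eigenvalues (S (-1)) ! i \<le> sorted_eigenvalues A ! i"
      by (rule sorted_eigenvalues_mono[OF hS hA _ i]) (use AB in \<open>auto simp: qS abs_le_iff algebra_simps\<close>)
    moreover have "sorted_eigenvalues (S (-1)) ! i \<le> sorted_eigenvalues B ! i"
      by (rule sorted_eigenvalues_mono[OF hS hB _ i]) (use R0 in \<open>auto simp: qS\<close>)
    ultimately show "\<bar>sorted_eigenvalues A ! i - sorted_eigenvalues B ! i\<bar>
        \<le> sorted_eigenvalues (S 1) ! i - sorted_eigenvalues (S (-1)) ! i"
      by linarith
  qed
  \<comment> \<open>Sums of eigenvalues are traces, and the traces of B + D and B - D differ by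
    twice the sum of all \<open>r i\<close>, which is the entrywise norm.\<close>
  also have "\<dots> = (\<Sum>i<n. Re (S 1 $$ (i, i)) - Re (S (-1) $$ (i, i)))"
    unfolding sum_subtractf hermitian_trace[OF hS] ..
  also have "\<dots> = (\<Sum>i<n. 2 * r i)"
    by (intro sum.cong refl) (simp add: S_def)
  also have "\<dots> = 2 * entry_norm1 (A - B)"
    unfolding entry_norm1_def r_def sum_distrib_left[symmetric] using A B by (auto intro!: sum.cong)
  finally show ?thesis .
qed

section \<open>Extreme eigenvalues from a form bound and one eigenvector\<close>

lemma eigenvalue_in_sorted_eigenvalues:
  assumes M: "M \<in> carrier_mat n n"
    and v: "v \<in> carrier_vec n" "v \<noteq> 0\<^sub>v n" "M *\<^sub>v v = complex_of_real c \<cdot>\<^sub>v v"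
  shows "c \<in> set (sorted_eigenvalues M)"
proof -
  have "eigenvalue M (complex_of_real c)"
    unfolding eigenvalue_def eigenvector_def using v M by auto
  then have "poly (char_poly M) (complex_of_real c) = 0" using eigenvalue_root_char_poly[OF M] by simp
  moreover have "char_poly M \<noteq> 0" using degree_monic_char_poly[OF M] by auto
  ultimately show "c \<in> set (sorted_eigenvalues M)"
    unfolding sorted_eigenvalues_def by (auto intro!: image_eqI[of _ _ "complex_of_real c"])
qed

lemma eigenbasis_vector:
  assumes u: "eigenbasis n M u" and l: "l < n"
  shows "qform n M (u l) = sorted_eigenvalues M ! l" and "(\<Sum>i<n. (cmod (u l i))\<^sup>2) = 1"
proof -
  have sq: "(cmod (\<Sum>j<n. cnj (u k j) * u l j))\<^sup>2 = (if k = l then 1 else 0)" if "k < n" for k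
    unfolding eigenbasisD(1)[OF u that l] by simp
  have "qform n M (u l) = (\<Sum>k<n. if k = l then sorted_eigenvalues M ! k else 0)"
    unfolding qform_eigenbasis[OF u] by (intro sum.cong refl) (simp add: sq)
  then show "qform n M (u l) = sorted_eigenvalues M ! l" using l by simp
  have "(\<Sum>i<n. (cmod (u l i))\<^sup>2) = (\<Sum>k<n. if k = l then 1 else 0)"
    unfolding eigenbasis_parseval[OF u, of "u l"] by (intro sum.cong refl) (simp add: sq)
  then show "(\<Sum>i<n. (cmod (u l i))\<^sup>2) = 1" using l by simp
qed

text \<open>The form bound, tested on a unit eigenvector of the largest eigenvalue, caps that
  eigenvalue by c. The vector v puts c into the sorted list, hence below its last entry.\<close>

lemma sorted_eigenvalue_last:
  assumes h: "hermitian_mat n M" and n: "n > 0"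
    and le: "\<And>x. qform n M x \<le> c * (\<Sum>i<n. (cmod (x i))\<^sup>2)"
    and v: "v \<in> carrier_vec n" "v \<noteq> 0\<^sub>v n" "M *\<^sub>v v = complex_of_real c \<cdot>\<^sub>v v"
  shows "sorted_eigenvalues M ! (n - 1) = c"
proof (rule antisym)
  obtain u where u: "eigenbasis n M u" using hermitian_eigenbasis[OF h] by blast
  have l: "n - 1 < n" using n by simp
  show "sorted_eigenvalues M ! (n - 1) \<le> c"
    using le[of "u (n - 1)"] unfolding eigenbasis_vector[OF u l] by simp
  obtain k where k: "k < n" "sorted_eigenvalues M ! k = c"
    using eigenvalue_in_sorted_eigenvalues[OF hermitian_mat_carrier[OF h] v]
    unfolding in_set_conv_nth length_sorted_eigenvalues[OF h] by blast
  have "sorted_eigenvalues M ! k \<le> sorted_eigenvalues M ! (n - 1)"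
    by (rule sorted_nth_mono[OF sorted_eigenvalues_sorted])
      (use k(1) l length_sorted_eigenvalues[OF h] in simp_all)
  then show "c \<le> sorted_eigenvalues M ! (n - 1)" unfolding k(2) .
qed

lemma sorted_eigenvalue_first:
  assumes h: "hermitian_mat n M" and n: "n > 0"
    and ge: "\<And>x. c * (\<Sum>i<n. (cmod (x i))\<^sup>2) \<le> qform n M x"
    and v: "v \<in> carrier_vec n" "v \<noteq> 0\<^sub>v n" "M *\<^sub>v v = complex_of_real c \<cdot>\<^sub>v v"
  shows "sorted_eigenvalues M ! 0 = c"
proof (rule antisym)
  obtain u where u: "eigenbasis n M u" using hermitian_eigenbasis[OF h] by blast
  show "c \<le> sorted_eigenvalues M ! 0"
    using ge[of "u 0"] unfolding eigenbasis_vector[OF u n] by simp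
  obtain k where k: "k < n" "sorted_eigenvalues M ! k = c"
    using eigenvalue_in_sorted_eigenvalues[OF hermitian_mat_carrier[OF h] v]
    unfolding in_set_conv_nth length_sorted_eigenvalues[OF h] by blast
  have "sorted_eigenvalues M ! 0 \<le> sorted_eigenvalues M ! k"
    by (rule sorted_nth_mono[OF sorted_eigenvalues_sorted])
      (use k(1) length_sorted_eigenvalues[OF h] in simp_all)
  then show "sorted_eigenvalues M ! 0 \<le> c" unfolding k(2) .
qed

section \<open>Lattice translations and edges of the fundamental graph\<close>

lemma lattice_vector_add: "lattice_vector a (m + m') = lattice_vector a m + lattice_vector a m'"
  by (simp add: lattice_vector_def scaleR_left_distrib sum.distrib)

lemma lattice_vector_0 [simp]: "lattice_vector a 0 = 0"
  by (simp add: lattice_vector_def)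

lemma lattice_vector_uminus: "lattice_vector a (- m) = - lattice_vector a m"
  by (simp add: lattice_vector_def sum_negf)

lemma lattice_vector_axis: "lattice_vector a (axis s 1) = a s"
proof -
  have "lattice_vector a (axis s 1) = (\<Sum>t\<in>UNIV. if t = s then a t else 0)"
    unfolding lattice_vector_def by (intro sum.cong refl) (simp add: axis_def)
  then show ?thesis by simp
qed

lemma pairing_add: "pairing (m + m') \<theta> = pairing m \<theta> + pairing m' \<theta>"
  by (simp add: pairing_def sum.distrib distrib_right)

lemma pairing_0 [simp]: "pairing 0 \<theta> = 0" "pairing m 0 = 0"
  by (simp_all add: pairing_def)

lemma pairing_uminus: "pairing (- m) \<theta> = - pairing m \<theta>"
  by (simp add: pairing_def sum_negf)

lemma pairing_axis: "pairing (axis s 1) \<theta> = \<theta> $ s"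
proof -
  have "pairing (axis s 1) \<theta> = (\<Sum>t\<in>UNIV. if t = s then \<theta> $ t else 0)"
    unfolding pairing_def by (intro sum.cong refl) (simp add: axis_def)
  then show ?thesis by simp
qed

text \<open>Invariance under the lattice is known for single periods only. The step is an
  equivalence, so that negative coordinates are reached as well.\<close>

lemma int_vec_induct:
  fixes P :: "int^'n \<Rightarrow> bool"
  assumes "P 0" and step: "\<And>m s. P m \<longleftrightarrow> P (m + axis s 1)"
  shows "P m"
proof -
  have mult: "P k \<longleftrightarrow> P (k + axis s i)" for k s and i :: int
  proof (induction i rule: int_induct[where k = 0])
    case base
    then show ?case by (metis add.right_neutral axis_eq_0_iff)
  next
    case (step1 i)
    have "k + axis s (i + 1) = k + axis s i + axis s 1"
      by (simp add: Finite_Cartesian_Product.vec_eq_iff axis_def)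
    with step1 step[of "k + axis s i" s] show ?case by metis
  next
    case (step2 i)
    have "k + axis s i = k + axis s (i - 1) + axis s 1"
      by (simp add: Finite_Cartesian_Product.vec_eq_iff axis_def)
    with step2 step[of "k + axis s (i - 1)" s] show ?case by metis
  qed
  \<comment> \<open>The coordinates of m are filled in one at a time, over a growing set S.\<close>
  have "P (\<chi> s. if s \<in> S then m $ s else 0)" if "finite S" for S
    using that
  proof (induction S rule: finite_induct)
    case empty
    have "(\<chi> s. if s \<in> {} then m $ s else 0) = 0" by (simp add: Finite_Cartesian_Product.vec_eq_iff)
    then show ?case using \<open>P 0\<close> by simp
  next
    case (insert t S)
    have "(\<chi> s. if s \<in> insert t S then m $ s else 0) = (\<chi> s. if s \<in> S then m $ s else 0) + axis t (m $ t)"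
      using insert.hyps by (auto simp: Finite_Cartesian_Product.vec_eq_iff axis_def)
    with insert.IH mult[of "\<chi> s. if s \<in> S then m $ s else 0" t "m $ t"] show ?case by simp
  qed
  from this[of UNIV] show ?thesis by simp
qed

lemma fst_translate_edge: "fst (translate_edge w e) = w + fst e"
  by (simp add: translate_edge_def split: prod.splits)

lemma fst_snd_translate_edge: "fst (snd (translate_edge w e)) = w + fst (snd e)"
  by (simp add: translate_edge_def split: prod.splits)

lemma translate_edge_0: "translate_edge 0 e = e"
  by (simp add: translate_edge_def split: prod.splits)

lemma translate_edge_add: "translate_edge w (translate_edge w' e) = translate_edge (w + w') e"
  by (simp add: translate_edge_def add.assoc split: prod.splits)

locale periodic_lattice =
  fixes \<Gamma> :: "(real^'n, 'l) multigraph" and a :: "'n \<Rightarrow> real^'n" and x\<^sub>0 :: "real^'n"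
  assumes periodic: "periodic_graph \<Gamma>" and periods: "periods \<Gamma> a"

context periodic_lattice begin

lemma vertices_translate: "lattice_vector a m + v \<in> vertices \<Gamma> \<longleftrightarrow> v \<in> vertices \<Gamma>"
proof -
  have one: "a s + v \<in> vertices \<Gamma> \<longleftrightarrow> v \<in> vertices \<Gamma>" for s v
  proof -
    have "vertices (translate_graph (a s) \<Gamma>) = vertices \<Gamma>" using periods unfolding periods_def by simp
    then have "(+) (a s) ` vertices \<Gamma> = vertices \<Gamma>" by (simp add: translate_graph_def)
    then show ?thesis by (metis add_left_imp_eq imageE imageI)
  qed
  have "\<forall>v. lattice_vector a m + v \<in> vertices \<Gamma> \<longleftrightarrow> v \<in> vertices \<Gamma>"
  proof (induction m rule: int_vec_induct)
    case (2 m s)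
    have eq: "lattice_vector a (m + axis s 1) + v = a s + (lattice_vector a m + v)" for v
      by (simp add: lattice_vector_add lattice_vector_axis)
    show ?case unfolding eq one ..
  qed simp
  then show ?thesis by blast
qed

lemma edges_translate:
  "(Upair (lattice_vector a m + u) (lattice_vector a m + v), l) \<in> edges \<Gamma> \<longleftrightarrow> (Upair u v, l) \<in> edges \<Gamma>"
proof -
  have one: "(Upair (a s + u) (a s + v), l) \<in> edges \<Gamma> \<longleftrightarrow> (Upair u v, l) \<in> edges \<Gamma>" for s u v
  proof -
    have "edges (translate_graph (a s) \<Gamma>) = edges \<Gamma>" using periods unfolding periods_def by simp
    then have img: "(\<lambda>(p, l). (map_uprod ((+) (a s)) p, l)) ` edges \<Gamma> = edges \<Gamma>"
      by (simp add: translate_graph_def)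
    show ?thesis
    proof
      assume "(Upair u v, l) \<in> edges \<Gamma>"
      then have "(Upair (a s + u) (a s + v), l) \<in> (\<lambda>(p, l). (map_uprod ((+) (a s)) p, l)) ` edges \<Gamma>"
        by (rule rev_image_eqI) simp
      then show "(Upair (a s + u) (a s + v), l) \<in> edges \<Gamma>" unfolding img .
    next
      assume "(Upair (a s + u) (a s + v), l) \<in> edges \<Gamma>"
      then obtain p where p: "(p, l) \<in> edges \<Gamma>" "Upair (a s + u) (a s + v) = map_uprod ((+) (a s)) p"
        by (subst (asm) img[symmetric]) auto
      then have "p = Upair u v" by (cases p) (auto simp: Upair_inject)
      with p show "(Upair u v, l) \<in> edges \<Gamma>" by simp
    qed
  qed
  have "\<forall>u v. (Upair (lattice_vector a m + u) (lattice_vector a m + v), l) \<in> edges \<Gamma> \<longleftrightarrow> (Upair u v, l) \<in> edges \<Gamma>"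
  proof (induction m rule: int_vec_induct)
    case (2 m s)
    have eq: "lattice_vector a (m + axis s 1) + v = a s + (lattice_vector a m + v)" for v
      by (simp add: lattice_vector_add lattice_vector_axis)
    show ?case unfolding eq one ..
  qed simp
  then show ?thesis by blast
qed

lemma oriented_edges_translate:
  "translate_edge (lattice_vector a m) e \<in> oriented_edges \<Gamma> \<longleftrightarrow> e \<in> oriented_edges \<Gamma>"
  by (cases e) (auto simp: translate_edge_def oriented_edges_def edges_translate)

lemma coordinates_translate:
  "coordinates a x\<^sub>0 (lattice_vector a m + v) $ s = coordinates a x\<^sub>0 v $ s + of_int (m $ s)"
proof -
  have ind: "independent (range a)" and sp: "span (range a) = UNIV" and inj: "inj a"
    using periods unfolding periods_def by auto
  have lat: "representation (range a) (lattice_vector a m) (a s) = of_int (m $ s)"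
  proof -
    have "representation (range a) (lattice_vector a m) (a s)
        = (\<Sum>t\<in>UNIV. representation (range a) (of_int (m $ t) *\<^sub>R a t) (a s))"
      unfolding lattice_vector_def by (subst representation_sum[OF ind]) (auto simp: sp)
    also have "\<dots> = (\<Sum>t\<in>UNIV. if t = s then of_int (m $ t) else 0)"
    proof (intro sum.cong refl)
      fix t
      have "representation (range a) (of_int (m $ t) *\<^sub>R a t) (a s)
          = of_int (m $ t) * representation (range a) (a t) (a s)"
        by (subst representation_scale[OF ind]) (auto simp: sp)
      also have "representation (range a) (a t) (a s) = (if t = s then 1 else 0)"
        using inj by (subst representation_basis[OF ind]) (auto dest: injD)
      finally show "representation (range a) (of_int (m $ t) *\<^sub>R a t) (a s)
          = (if t = s then of_int (m $ t) else 0)" by simp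
    qed
    also have "\<dots> = of_int (m $ s)" by simp
    finally show ?thesis .
  qed
  have eq: "lattice_vector a m + v - x\<^sub>0 = (v - x\<^sub>0) + lattice_vector a m" by simp
  have "representation (range a) ((v - x\<^sub>0) + lattice_vector a m)
      = (\<lambda>b. representation (range a) (v - x\<^sub>0) b + representation (range a) (lattice_vector a m) b)"
    by (rule representation_add[OF ind]) (simp_all add: sp)
  then show ?thesis unfolding coordinates_def eq using lat by simp
qed

lemma integer_part_translate: "integer_part a x\<^sub>0 (lattice_vector a m + v) = m + integer_part a x\<^sub>0 v"
  by (simp add: integer_part_def Finite_Cartesian_Product.vec_eq_iff coordinates_translate)

lemma fractional_part_translate: "fractional_part a x\<^sub>0 (lattice_vector a m + v) = fractional_part a x\<^sub>0 v"
  by (simp add: fractional_part_def integer_part_translate lattice_vector_add)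

lemma fractional_integer_part: "lattice_vector a (integer_part a x\<^sub>0 v) + fractional_part a x\<^sub>0 v = v"
  by (simp add: fractional_part_def)

lemma fractional_part_in_fundamental:
  assumes "v \<in> vertices \<Gamma>"
  shows "fractional_part a x\<^sub>0 v \<in> fundamental_vertices \<Gamma> a x\<^sub>0"
proof -
  have eq: "fractional_part a x\<^sub>0 v = lattice_vector a (- integer_part a x\<^sub>0 v) + v"
    by (simp add: fractional_part_def lattice_vector_uminus)
  have "coordinates a x\<^sub>0 (fractional_part a x\<^sub>0 v) $ s = frac (coordinates a x\<^sub>0 v $ s)" for s
    unfolding eq coordinates_translate by (simp add: integer_part_def frac_def)
  then have "0 \<le> coordinates a x\<^sub>0 (fractional_part a x\<^sub>0 v) $ s \<and>
      coordinates a x\<^sub>0 (fractional_part a x\<^sub>0 v) $ s < 1" for s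
    by (simp add: frac_lt_1)
  moreover have "fractional_part a x\<^sub>0 v \<in> vertices \<Gamma>"
    unfolding eq vertices_translate by (rule assms)
  ultimately show ?thesis unfolding fundamental_vertices_def by blast
qed

lemma integer_part_fundamental:
  "v \<in> fundamental_vertices \<Gamma> a x\<^sub>0 \<Longrightarrow> integer_part a x\<^sub>0 v = 0"
  by (auto simp: fundamental_vertices_def integer_part_def Finite_Cartesian_Product.vec_eq_iff floor_eq_iff)

lemma fractional_part_fundamental:
  "v \<in> fundamental_vertices \<Gamma> a x\<^sub>0 \<Longrightarrow> fractional_part a x\<^sub>0 v = v"
  by (simp add: fractional_part_def integer_part_fundamental)

section \<open>Oriented edges modulo the lattice\<close>

lemma oriented_edge_vertices:
  assumes "e \<in> oriented_edges \<Gamma>"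
  shows "fst e \<in> vertices \<Gamma>" "fst (snd e) \<in> vertices \<Gamma>"
  using assms periodic unfolding periodic_graph_def oriented_edges_def by force+

lemma edge_index_alt: "edge_index a x\<^sub>0 e = integer_part a x\<^sub>0 (fst (snd e)) - integer_part a x\<^sub>0 (fst e)"
  by (simp add: edge_index_def split: prod.splits)

lemma edge_index_translate: "edge_index a x\<^sub>0 (translate_edge (lattice_vector a m) e) = edge_index a x\<^sub>0 e"
  by (simp add: edge_index_alt fst_translate_edge fst_snd_translate_edge integer_part_translate)

text \<open>The lattice orbit as an explicit image. For an oriented edge it is the class under
  \<open>translation_equivalence\<close>, because translates stay oriented edges.\<close>

definition edge_class :: "(real^'n, 'l) oriented_edge \<Rightarrow> (real^'n, 'l) oriented_edge set" where
  "edge_class e = range (\<lambda>m. translate_edge (lattice_vector a m) e)"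

lemma translation_class:
  "e \<in> oriented_edges \<Gamma> \<Longrightarrow> translation_equivalence \<Gamma> a `` {e} = edge_class e"
  by (auto simp: translation_equivalence_def edge_class_def oriented_edges_translate)

lemma edge_class_translate: "edge_class (translate_edge (lattice_vector a k) e) = edge_class e"
proof -
  have "edge_class (translate_edge (lattice_vector a k) e)
      = range ((\<lambda>m. translate_edge (lattice_vector a m) e) \<circ> (\<lambda>m. m + k))"
    by (simp add: edge_class_def translate_edge_add lattice_vector_add comp_def)
  also have "\<dots> = (\<lambda>m. translate_edge (lattice_vector a m) e) ` range (\<lambda>m. m + k)"
    by (rule image_comp[symmetric])
  also have "range (\<lambda>m. m + k) = UNIV"
    by (metis surj_def diff_add_cancel)
  finally show ?thesis unfolding edge_class_def .
qed

lemma arcs_fundamental_graph: "arcs (fundamental_graph \<Gamma> a x\<^sub>0) = edge_class ` oriented_edges \<Gamma>"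
  using translation_class by (auto simp: fundamental_graph_def quotient_def image_iff)

text \<open>Used for tail, head and index: each is invariant under the lattice, so
  \<open>the_elem\<close> returns its value at any representative.\<close>

lemma edge_class_the_elem:
  assumes "\<And>m. f (translate_edge (lattice_vector a m) e) = f e"
  shows "the_elem (f ` edge_class e) = f e"
proof -
  have "f ` edge_class e = {f e}" unfolding edge_class_def image_image using assms by auto
  then show ?thesis by simp
qed

lemma tail_edge_class: "tail (fundamental_graph \<Gamma> a x\<^sub>0) (edge_class e) = fractional_part a x\<^sub>0 (fst e)"
proof -
  have eq: "(\<lambda>e. fractional_part a x\<^sub>0 (tail (oriented_graph \<Gamma>) e)) = (\<lambda>e. fractional_part a x\<^sub>0 (fst e))"
    by (auto simp: oriented_graph_def)
  show ?thesis
    unfolding fundamental_graph_def pre_digraph.simps eq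
    by (rule edge_class_the_elem) (simp add: fst_translate_edge fractional_part_translate)
qed

lemma head_edge_class: "head (fundamental_graph \<Gamma> a x\<^sub>0) (edge_class e) = fractional_part a x\<^sub>0 (fst (snd e))"
proof -
  have eq: "(\<lambda>e. fractional_part a x\<^sub>0 (head (oriented_graph \<Gamma>) e)) = (\<lambda>e. fractional_part a x\<^sub>0 (fst (snd e)))"
    by (auto simp: oriented_graph_def)
  show ?thesis
    unfolding fundamental_graph_def pre_digraph.simps eq
    by (rule edge_class_the_elem) (simp add: fst_snd_translate_edge fractional_part_translate)
qed

lemma class_index_edge_class: "class_index a x\<^sub>0 (edge_class e) = edge_index a x\<^sub>0 e"
  unfolding class_index_def by (rule edge_class_the_elem) (rule edge_index_translate)

text \<open>Representatives of the classes from v to w, for v in the fundamental cell, that start at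
  v itself; the head is some translate of w.\<close>

definition out_edges :: "real^'n \<Rightarrow> real^'n \<Rightarrow> (real^'n, 'l) oriented_edge set" where
  "out_edges v w = {e \<in> oriented_edges \<Gamma>. fst e = v \<and> fractional_part a x\<^sub>0 (fst (snd e)) = w}"

text \<open>Translating by minus the integer part of the tail moves any edge of a class with tail v
  to one starting at v itself; two such edges differ by a lattice vector fixing v, hence by zero.
  Sums over arcs of the fundamental graph thereby become sums over edges of \<Gamma>.\<close>

lemma edge_class_bij:
  assumes v: "v \<in> fundamental_vertices \<Gamma> a x\<^sub>0"
  shows "bij_betw edge_class (out_edges v w)
    {E. E \<in> arcs (fundamental_graph \<Gamma> a x\<^sub>0) \<and> tail (fundamental_graph \<Gamma> a x\<^sub>0) E = v \<and>
        head (fundamental_graph \<Gamma> a x\<^sub>0) E = w}"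
proof (rule bij_betw_imageI)
  show "inj_on edge_class (out_edges v w)"
  proof (rule inj_onI)
    fix e e' assume e: "e \<in> out_edges v w" "e' \<in> out_edges v w" and eq: "edge_class e = edge_class e'"
    have "e' \<in> edge_class e'" unfolding edge_class_def by (rule range_eqI[of _ _ 0]) (simp add: translate_edge_0)
    then have "e' \<in> edge_class e" unfolding eq .
    then obtain m where m: "e' = translate_edge (lattice_vector a m) e"
      unfolding edge_class_def by auto
    have "lattice_vector a m = 0"
      using e fst_translate_edge[of "lattice_vector a m" e] unfolding m[symmetric] out_edges_def by simp
    then show "e = e'" unfolding m by (simp add: translate_edge_0)
  qed
  show "edge_class ` out_edges v w = {E. E \<in> arcs (fundamental_graph \<Gamma> a x\<^sub>0) \<and>
      tail (fundamental_graph \<Gamma> a x\<^sub>0) E = v \<and> head (fundamental_graph \<Gamma> a x\<^sub>0) E = w}"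
  proof (intro equalityI subsetI)
    fix E assume "E \<in> edge_class ` out_edges v w"
    then show "E \<in> {E. E \<in> arcs (fundamental_graph \<Gamma> a x\<^sub>0) \<and>
        tail (fundamental_graph \<Gamma> a x\<^sub>0) E = v \<and> head (fundamental_graph \<Gamma> a x\<^sub>0) E = w}"
      using fractional_part_fundamental[OF v]
      by (auto simp: out_edges_def arcs_fundamental_graph tail_edge_class head_edge_class)
  next
    fix E assume "E \<in> {E. E \<in> arcs (fundamental_graph \<Gamma> a x\<^sub>0) \<and>
        tail (fundamental_graph \<Gamma> a x\<^sub>0) E = v \<and> head (fundamental_graph \<Gamma> a x\<^sub>0) E = w}"
    then obtain e where e: "e \<in> oriented_edges \<Gamma>" "E = edge_class e"
      "fractional_part a x\<^sub>0 (fst e) = v" "fractional_part a x\<^sub>0 (fst (snd e)) = w"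
      by (auto simp: arcs_fundamental_graph tail_edge_class head_edge_class)
    define k where "k = - integer_part a x\<^sub>0 (fst e)"
    have "lattice_vector a k + fst e = v"
      using e(3) by (simp add: k_def lattice_vector_uminus fractional_part_def)
    then have "translate_edge (lattice_vector a k) e \<in> out_edges v w"
      using e by (simp add: out_edges_def oriented_edges_translate fst_translate_edge
          fst_snd_translate_edge fractional_part_translate)
    then show "E \<in> edge_class ` out_edges v w"
      unfolding e(2) edge_class_translate[of k e, symmetric] by (rule imageI)
  qed
qed

lemma out_edges_head:
  assumes "v \<in> fundamental_vertices \<Gamma> a x\<^sub>0" "e \<in> out_edges v w"
  shows "edge_index a x\<^sub>0 e = integer_part a x\<^sub>0 (fst (snd e))"
    and "fst (snd e) = lattice_vector a (edge_index a x\<^sub>0 e) + w"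
proof -
  show 1: "edge_index a x\<^sub>0 e = integer_part a x\<^sub>0 (fst (snd e))"
    using assms integer_part_fundamental[OF assms(1)] by (simp add: edge_index_alt out_edges_def)
  show "fst (snd e) = lattice_vector a (edge_index a x\<^sub>0 e) + w"
    unfolding 1 using assms(2) fractional_integer_part[of "fst (snd e)"] by (simp add: out_edges_def)
qed

text \<open>The reversal of \<open>(v, w + m)\<close>, translated so that its tail is \<open>w\<close> again.\<close>

definition reverse_edge :: "(real^'n, 'l) oriented_edge \<Rightarrow> (real^'n, 'l) oriented_edge" where
  "reverse_edge = (\<lambda>(u, x, l, b). (fractional_part a x\<^sub>0 x, u - lattice_vector a (integer_part a x\<^sub>0 x), l, b))"

text \<open>The flag is kept, so a genuine loop is its own reversal; this agrees with the sign
  change of the index, which is 0 there.\<close>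

lemma reverse_edge_out:
  assumes v: "v \<in> fundamental_vertices \<Gamma> a x\<^sub>0" and w: "w \<in> fundamental_vertices \<Gamma> a x\<^sub>0"
    and e: "e \<in> out_edges v w"
  shows "reverse_edge e \<in> out_edges w v" "edge_index a x\<^sub>0 (reverse_edge e) = - edge_index a x\<^sub>0 e"
    "reverse_edge (reverse_edge e) = e"
proof -
  obtain x l b where ex: "e = (v, x, l, b)" and o: "e \<in> oriented_edges \<Gamma>" and fx: "fractional_part a x\<^sub>0 x = w"
    using e by (cases e) (auto simp: out_edges_def)
  define m where "m = integer_part a x\<^sub>0 x"
  have x: "x = lattice_vector a m + w" using fractional_integer_part[of x] fx by (simp add: m_def)
  have r: "reverse_edge e = (w, lattice_vector a (- m) + v, l, b)"
    by (simp add: ex reverse_edge_def fx m_def lattice_vector_uminus)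
  have iv: "integer_part a x\<^sub>0 v = 0" "integer_part a x\<^sub>0 w = 0"
    using integer_part_fundamental v w by auto
  have fv: "fractional_part a x\<^sub>0 v = v" using fractional_part_fundamental v by auto
  have "translate_edge (lattice_vector a m) (reverse_edge e) = (x, v, l, b)"
    unfolding r by (simp add: translate_edge_def x lattice_vector_uminus)
  moreover have "(x, v, l, b) \<in> oriented_edges \<Gamma>"
  proof -
    have "(Upair v x, l) \<in> edges \<Gamma>" "b \<longrightarrow> x = v"
      using o unfolding ex oriented_edges_def by auto
    moreover have "Upair v x = Upair x v" by simp
    ultimately have "(Upair x v, l) \<in> edges \<Gamma>" by metis
    then show ?thesis using \<open>b \<longrightarrow> x = v\<close> unfolding oriented_edges_def by simp
  qed
  ultimately have "reverse_edge e \<in> oriented_edges \<Gamma>" using oriented_edges_translate by metis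
  then show "reverse_edge e \<in> out_edges w v"
    unfolding out_edges_def r by (simp add: fractional_part_translate fv)
  show "edge_index a x\<^sub>0 (reverse_edge e) = - edge_index a x\<^sub>0 e"
    unfolding r unfolding ex edge_index_alt by (simp add: integer_part_translate iv flip: m_def)
  show "reverse_edge (reverse_edge e) = e"
  proof -
    have "reverse_edge (reverse_edge e) = (v, w - lattice_vector a (- m), l, b)"
      unfolding r by (simp add: reverse_edge_def fractional_part_translate fv integer_part_translate iv)
    then show ?thesis by (simp add: ex x lattice_vector_uminus add.commute)
  qed
qed

text \<open>Reversal as a change of variables. For w = v it pairs opposite phases and makes the
  diagonal sums real; in general it gives the symmetry of the Floquet matrix.\<close>

lemma sum_out_edges_reverse:
  fixes f :: "int^'n \<Rightarrow> 'b :: comm_monoid_add"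
  assumes v: "v \<in> fundamental_vertices \<Gamma> a x\<^sub>0" and w: "w \<in> fundamental_vertices \<Gamma> a x\<^sub>0"
  shows "(\<Sum>e\<in>out_edges v w. f (edge_index a x\<^sub>0 e)) = (\<Sum>e\<in>out_edges w v. f (- edge_index a x\<^sub>0 e))"
  by (rule sum.reindex_bij_witness[of _ reverse_edge reverse_edge])
    (auto simp: reverse_edge_out[OF v w] reverse_edge_out[OF w v])

text \<open>Unflagged oriented edges leaving v correspond to incident edges, flagged ones to loops
  at v, so a loop counts twice on both sides.\<close>

lemma finite_out_edges_degree:
  assumes v: "v \<in> vertices \<Gamma>"
  shows "finite {e \<in> oriented_edges \<Gamma>. fst e = v}"
    and "vertex_degree \<Gamma> v = card {e \<in> oriented_edges \<Gamma>. fst e = v}"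
proof -
  let ?I = "incident \<Gamma> v" and ?L = "{e \<in> edges \<Gamma>. fst e = Upair v v}"
  define F where "F = {e \<in> oriented_edges \<Gamma>. fst e = v \<and> \<not> snd (snd (snd e))}"
  define T where "T = {e \<in> oriented_edges \<Gamma>. fst e = v \<and> snd (snd (snd e))}"
  define g where "g = (\<lambda>(u :: real^'n, x, l :: 'l, b :: bool). (Upair u x, l))"
  have fin: "finite ?I" using periodic v unfolding periodic_graph_def by blast
  have "?L \<subseteq> ?I" by (auto simp: incident_def)
  then have finL: "finite ?L" using fin finite_subset by blast
  have F: "bij_betw g F ?I"
  proof (rule bij_betw_imageI)
    show "inj_on g F" by (auto simp: inj_on_def F_def g_def Upair_inject)
    show "g ` F = ?I"
    proof (intro equalityI subsetI)
      fix e assume "e \<in> g ` F"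
      then show "e \<in> ?I" by (auto simp: F_def g_def incident_def oriented_edges_def)
    next
      fix e assume e: "e \<in> ?I"
      obtain p l where pl: "e = (p, l)" by (cases e)
      obtain x where "p = Upair v x"
        using e unfolding incident_def pl by (cases p) (auto simp: Upair_inject)
      then have "(v, x, l, False) \<in> F" "g (v, x, l, False) = e"
        using e unfolding incident_def pl by (auto simp: F_def g_def oriented_edges_def)
      then show "e \<in> g ` F" by (metis imageI)
    qed
  qed
  have T: "bij_betw g T ?L"
  proof (rule bij_betw_imageI)
    show "inj_on g T" by (auto simp: inj_on_def T_def g_def Upair_inject)
    show "g ` T = ?L"
    proof (intro equalityI subsetI)
      fix e assume "e \<in> g ` T"
      then show "e \<in> ?L" by (auto simp: T_def g_def oriented_edges_def)
    next
      fix e assume e: "e \<in> ?L"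
      then obtain l where "e = (Upair v v, l)" by (cases e) auto
      with e have "(v, v, l, True) \<in> T" "g (v, v, l, True) = e"
        by (auto simp: T_def g_def oriented_edges_def)
      then show "e \<in> g ` T" by (metis imageI)
    qed
  qed
  have FT: "{e \<in> oriented_edges \<Gamma>. fst e = v} = F \<union> T" "F \<inter> T = {}"
    by (auto simp: F_def T_def)
  have finF: "finite F" "finite T" using F T fin finL bij_betw_finite by blast+
  then show "finite {e \<in> oriented_edges \<Gamma>. fst e = v}" unfolding FT by simp
  show "vertex_degree \<Gamma> v = card {e \<in> oriented_edges \<Gamma>. fst e = v}"
    unfolding FT(1) vertex_degree_def card_Un_disjoint[OF finF FT(2)]
    using bij_betw_same_card[OF F] bij_betw_same_card[OF T] by simp
qed

end

section \<open>Floquet matrices of loop graphs\<close>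

locale loop_floquet = periodic_lattice \<Gamma> a x\<^sub>0
  for \<Gamma> :: "(real^'n, 'l) multigraph" and a :: "'n \<Rightarrow> real^'n" and x\<^sub>0 :: "real^'n" +
  fixes vs :: "(real^'n) list"
  assumes loop: "loop_fundamental_graph \<Gamma> a x\<^sub>0" and numbering: "vertex_numbering \<Gamma> a x\<^sub>0 vs"

context loop_floquet begin

lemma nth_vs: "j < length vs \<Longrightarrow> vs ! j \<in> fundamental_vertices \<Gamma> a x\<^sub>0"
  using numbering unfolding vertex_numbering_def by (metis nth_mem)

lemma nth_vs_vertex: "j < length vs \<Longrightarrow> vs ! j \<in> vertices \<Gamma>"
  using nth_vs unfolding fundamental_vertices_def by blast

lemma nth_vs_eq: "j < length vs \<Longrightarrow> k < length vs \<Longrightarrow> vs ! j = vs ! k \<longleftrightarrow> j = k"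
  using numbering unfolding vertex_numbering_def by (simp add: nth_eq_iff_index_eq)

lemma vs_nonempty: "length vs > 0"
proof -
  \<comment> \<open>Connectedness of a digraph includes having at least one vertex.\<close>
  have "vertices \<Gamma> \<noteq> {}"
    using periodic unfolding periodic_graph_def connected_def strongly_connected_def
    by (auto simp: oriented_graph_def mk_symmetric_def)
  then obtain v where "v \<in> vertices \<Gamma>" by blast
  then have "fractional_part a x\<^sub>0 v \<in> set vs"
    using fractional_part_in_fundamental numbering unfolding vertex_numbering_def by blast
  then show ?thesis by (cases vs) auto
qed

text \<open>A nonzero index would make the class a bridge, and a bridge has equal tail and
  head.\<close>

lemma edge_index_nonloop:
  assumes v: "v \<in> fundamental_vertices \<Gamma> a x\<^sub>0" and e: "e \<in> out_edges v w" and "v \<noteq> w"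
  shows "edge_index a x\<^sub>0 e = 0"
proof (rule ccontr)
  assume nz: "edge_index a x\<^sub>0 e \<noteq> 0"
  have o: "e \<in> oriented_edges \<Gamma>" "fst e = v" "fractional_part a x\<^sub>0 (fst (snd e)) = w"
    using e by (auto simp: out_edges_def)
  have "edge_class e \<in> bridges \<Gamma> a x\<^sub>0"
    using o(1) nz unfolding bridges_def arcs_fundamental_graph by (auto simp: class_index_edge_class)
  then have "fractional_part a x\<^sub>0 (fst e) = fractional_part a x\<^sub>0 (fst (snd e))"
    using loop unfolding loop_fundamental_graph_def by (auto simp: tail_edge_class head_edge_class)
  then show False using o fractional_part_fundamental[OF v] \<open>v \<noteq> w\<close> by simp
qed

text \<open>The phase sum of a Floquet entry with cosines in place of exponentials (see
  \<open>sum_exp_out_edges\<close>), so that its extreme values in \<theta> can be read off edge by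
  edge.\<close>

definition hopping :: "real^'n \<Rightarrow> real^'n \<Rightarrow> real^'n \<Rightarrow> real" where
  "hopping \<theta> v w = (\<Sum>e\<in>out_edges v w. cos (pairing (edge_index a x\<^sub>0 e) \<theta>))"

lemma hopping_sym:
  assumes "v \<in> fundamental_vertices \<Gamma> a x\<^sub>0" "w \<in> fundamental_vertices \<Gamma> a x\<^sub>0"
  shows "hopping \<theta> v w = hopping \<theta> w v"
  unfolding hopping_def
  using sum_out_edges_reverse[OF assms, of "\<lambda>m. cos (pairing m \<theta>)"] by (simp add: pairing_uminus)

lemma hopping_nonloop:
  assumes "v \<in> fundamental_vertices \<Gamma> a x\<^sub>0" "v \<noteq> w"
  shows "hopping \<theta> v w = card (out_edges v w)"
  unfolding hopping_def using edge_index_nonloop[OF assms(1) _ assms(2)] by simp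

lemma hopping_0: "hopping 0 v w = card (out_edges v w)"
  unfolding hopping_def by simp

text \<open>For v \<noteq> w all indices vanish and all phases are 1. For v = w the sum equals its
  own reversal, and adding the two gives twice the cosines.\<close>

lemma sum_exp_out_edges:
  assumes v: "v \<in> fundamental_vertices \<Gamma> a x\<^sub>0" and w: "w \<in> fundamental_vertices \<Gamma> a x\<^sub>0"
  shows "(\<Sum>e\<in>out_edges v w. exp (\<i> * complex_of_real (pairing (edge_index a x\<^sub>0 e) \<theta>)))
    = complex_of_real (hopping \<theta> v w)"
proof (cases "v = w")
  case False
  then show ?thesis using edge_index_nonloop[OF v] hopping_nonloop[OF v False] by simp
next
  case True
  let ?f = "\<lambda>m. exp (\<i> * complex_of_real (pairing m \<theta>))"
  let ?S = "\<Sum>e\<in>out_edges v w. ?f (edge_index a x\<^sub>0 e)"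
  have "2 * ?S = (\<Sum>e\<in>out_edges v w. ?f (edge_index a x\<^sub>0 e)) + (\<Sum>e\<in>out_edges v w. ?f (- edge_index a x\<^sub>0 e))"
    using sum_out_edges_reverse[OF v w, of ?f] True by simp
  also have "\<dots> = (\<Sum>e\<in>out_edges v w. 2 * complex_of_real (cos (pairing (edge_index a x\<^sub>0 e) \<theta>)))"
    unfolding sum.distrib[symmetric]
  proof (intro sum.cong refl)
    fix e
    show "?f (edge_index a x\<^sub>0 e) + ?f (- edge_index a x\<^sub>0 e) = 2 * complex_of_real (cos (pairing (edge_index a x\<^sub>0 e) \<theta>))"
      unfolding pairing_uminus cis_conv_exp[symmetric] by (simp add: complex_eq_iff)
  qed
  also have "\<dots> = 2 * complex_of_real (hopping \<theta> v w)"
    unfolding hopping_def of_real_sum sum_distrib_left ..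
  finally show ?thesis by simp
qed

section \<open>Entries, eigenvalues and band edges of the Floquet matrix\<close>

lemma floquet_laplacian_carrier: "floquet_laplacian \<Gamma> a x\<^sub>0 vs \<theta> \<in> carrier_mat (length vs) (length vs)"
  unfolding floquet_laplacian_def by simp

lemma floquet_laplacian_index:
  assumes jk: "j < length vs" "k < length vs"
  shows "floquet_laplacian \<Gamma> a x\<^sub>0 vs \<theta> $$ (j, k) = complex_of_real
    ((if j = k then real (vertex_degree \<Gamma> (vs ! j)) else 0) - hopping \<theta> (vs ! j) (vs ! k))"
proof -
  have "(\<Sum>E | E \<in> arcs (fundamental_graph \<Gamma> a x\<^sub>0) \<and>
             tail (fundamental_graph \<Gamma> a x\<^sub>0) E = vs ! j \<and> head (fundamental_graph \<Gamma> a x\<^sub>0) E = vs ! k.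
          exp (\<i> * complex_of_real (pairing (class_index a x\<^sub>0 E) \<theta>)))
      = (\<Sum>e\<in>out_edges (vs ! j) (vs ! k). exp (\<i> * complex_of_real (pairing (class_index a x\<^sub>0 (edge_class e)) \<theta>)))"
    by (rule sum.reindex_bij_betw[OF edge_class_bij[OF nth_vs[OF jk(1)]], symmetric])
  also have "\<dots> = complex_of_real (hopping \<theta> (vs ! j) (vs ! k))"
    unfolding class_index_edge_class by (rule sum_exp_out_edges[OF nth_vs[OF jk(1)] nth_vs[OF jk(2)]])
  finally show ?thesis unfolding floquet_laplacian_def using jk by simp
qed

lemma floquet_matrix_carrier: "floquet_matrix \<Gamma> a x\<^sub>0 vs Q \<theta> \<in> carrier_mat (length vs) (length vs)"
  unfolding floquet_matrix_def by simp

lemma floquet_matrix_index: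
  assumes "j < length vs" "k < length vs"
  shows "floquet_matrix \<Gamma> a x\<^sub>0 vs Q \<theta> $$ (j, k) = complex_of_real
    ((if j = k then real (vertex_degree \<Gamma> (vs ! j)) + Q (vs ! j) else 0) - hopping \<theta> (vs ! j) (vs ! k))"
  unfolding floquet_matrix_def using assms floquet_laplacian_index[OF assms] by simp

lemma floquet_matrix_hermitian: "hermitian_mat (length vs) (floquet_matrix \<Gamma> a x\<^sub>0 vs Q \<theta>)"
  unfolding hermitian_mat_def
  using floquet_matrix_carrier hopping_sym[OF nth_vs nth_vs] by (auto simp: floquet_matrix_index)

lemma floquet_matrix_no_potential:
  assumes "\<And>v. v \<in> vertices \<Gamma> \<Longrightarrow> Q v = 0"
  shows "floquet_matrix \<Gamma> a x\<^sub>0 vs Q \<theta> = floquet_laplacian \<Gamma> a x\<^sub>0 vs \<theta>"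
proof (rule eq_matI)
  fix j k assume "j < dim_row (floquet_laplacian \<Gamma> a x\<^sub>0 vs \<theta>)" "k < dim_col (floquet_laplacian \<Gamma> a x\<^sub>0 vs \<theta>)"
  then have jk: "j < length vs" "k < length vs" unfolding floquet_laplacian_def by auto
  show "floquet_matrix \<Gamma> a x\<^sub>0 vs Q \<theta> $$ (j, k) = floquet_laplacian \<Gamma> a x\<^sub>0 vs \<theta> $$ (j, k)"
    using assms[OF nth_vs_vertex[OF jk(1)]] jk by (auto simp: floquet_matrix_index floquet_laplacian_index)
qed (simp_all add: floquet_matrix_def floquet_laplacian_def)

lemma floquet_laplacian_hermitian: "hermitian_mat (length vs) (floquet_laplacian \<Gamma> a x\<^sub>0 vs \<theta>)"
  using floquet_matrix_hermitian[of "\<lambda>_. 0" \<theta>] floquet_matrix_no_potential[of "\<lambda>_. 0" \<theta>] by simp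

text \<open>All bridges are loops, so only the diagonal of the Floquet matrix depends on the quasimomentum.\<close>

lemma eigenvalues_mono_hopping:
  assumes le: "\<And>v. v \<in> fundamental_vertices \<Gamma> a x\<^sub>0 \<Longrightarrow> hopping \<theta> v v \<le> hopping \<theta>' v v"
    and i: "i < length vs"
  shows "sorted_eigenvalues (floquet_matrix \<Gamma> a x\<^sub>0 vs Q \<theta>') ! i
    \<le> sorted_eigenvalues (floquet_matrix \<Gamma> a x\<^sub>0 vs Q \<theta>) ! i"
proof (rule sorted_eigenvalues_mono[OF floquet_matrix_hermitian floquet_matrix_hermitian _ i])
  fix x
  \<comment> \<open>The hopping enters with a minus sign, so \<open>r j\<close> is the nonnegative
    amount by which the diagonal at \<theta> exceeds the one at \<theta>'.\<close>
  define r where "r j = hopping \<theta>' (vs ! j) (vs ! j) - hopping \<theta> (vs ! j) (vs ! j)" for j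
  let ?n = "length vs"
  have "floquet_matrix \<Gamma> a x\<^sub>0 vs Q \<theta> = Matrix.mat ?n ?n
      (\<lambda>(i, j). floquet_matrix \<Gamma> a x\<^sub>0 vs Q \<theta>' $$ (i, j) + (if i = j then complex_of_real (r i) else 0))"
    (is "_ = ?M")
  proof (rule eq_matI)
    fix j k assume "j < dim_row ?M" "k < dim_col ?M"
    then have jk: "j < ?n" "k < ?n" by auto
    show "floquet_matrix \<Gamma> a x\<^sub>0 vs Q \<theta> $$ (j, k) = ?M $$ (j, k)"
    proof (cases "j = k")
      case True
      then show ?thesis using jk by (simp add: floquet_matrix_index r_def)
    next
      case False
      then have "vs ! j \<noteq> vs ! k" using nth_vs_eq[OF jk] by simp
      then have "hopping \<theta> (vs ! j) (vs ! k) = hopping \<theta>' (vs ! j) (vs ! k)"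
        using hopping_nonloop[OF nth_vs[OF jk(1)]] by metis
      then show ?thesis using jk False by (simp add: floquet_matrix_index)
    qed
  qed (simp_all add: floquet_matrix_def)
  then have "qform ?n (floquet_matrix \<Gamma> a x\<^sub>0 vs Q \<theta>) x = qform ?n ?M x" by (rule arg_cong)
  also have "\<dots> = qform ?n (floquet_matrix \<Gamma> a x\<^sub>0 vs Q \<theta>') x + (\<Sum>j<?n. r j * (cmod (x j))\<^sup>2)"
    by (rule qform_add_diag[OF floquet_matrix_carrier])
  finally have "qform ?n (floquet_matrix \<Gamma> a x\<^sub>0 vs Q \<theta>) x
      = qform ?n (floquet_matrix \<Gamma> a x\<^sub>0 vs Q \<theta>') x + (\<Sum>j<?n. r j * (cmod (x j))\<^sup>2)" .
  moreover have "(\<Sum>j<?n. r j * (cmod (x j))\<^sup>2) \<ge> 0"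
    using le[OF nth_vs] by (intro sum_nonneg) (simp add: r_def)
  ultimately show "qform ?n (floquet_matrix \<Gamma> a x\<^sub>0 vs Q \<theta>') x \<le> qform ?n (floquet_matrix \<Gamma> a x\<^sub>0 vs Q \<theta>) x"
    by linarith
qed

text \<open>At \<theta> = 0 all cosines reach their maximum 1 at once, so a single quasimomentum
  minimises every band function. Bands are numbered from 1, list positions from 0.\<close>

lemma band_min_eq:
  assumes "1 \<le> n" "n \<le> length vs"
  shows "band_min \<Gamma> a x\<^sub>0 vs Q n = sorted_eigenvalues (floquet_matrix \<Gamma> a x\<^sub>0 vs Q 0) ! (n - 1)"
  unfolding band_min_def spectral_band_def
proof (rule cInf_eq_minimum)
  show "sorted_eigenvalues (floquet_matrix \<Gamma> a x\<^sub>0 vs Q 0) ! (n - 1) \<in> range (band_function \<Gamma> a x\<^sub>0 vs Q n)"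
    by (rule range_eqI[of _ _ 0]) (simp add: band_function_def)
  fix y assume "y \<in> range (band_function \<Gamma> a x\<^sub>0 vs Q n)"
  then obtain \<theta> where y: "y = sorted_eigenvalues (floquet_matrix \<Gamma> a x\<^sub>0 vs Q \<theta>) ! (n - 1)"
    by (auto simp: band_function_def)
  show "sorted_eigenvalues (floquet_matrix \<Gamma> a x\<^sub>0 vs Q 0) ! (n - 1) \<le> y"
    unfolding y
  proof (rule eigenvalues_mono_hopping)
    show "hopping \<theta> v v \<le> hopping 0 v v" for v
      unfolding hopping_def by (intro sum_mono) simp
  qed (use assms in auto)
qed

text \<open>Edges of index 0 contribute the constant 1, and the cosines of all bridges reach -1
  together at \<open>\<theta>\<^sub>0\<close>; so this one point maximises every band
  function.\<close>

lemma band_max_eq: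
  assumes p: "precise_quasimomentum \<Gamma> a x\<^sub>0 \<theta>\<^sub>0" and n: "1 \<le> n" "n \<le> length vs"
  shows "band_max \<Gamma> a x\<^sub>0 vs Q n = sorted_eigenvalues (floquet_matrix \<Gamma> a x\<^sub>0 vs Q \<theta>\<^sub>0) ! (n - 1)"
  unfolding band_max_def spectral_band_def
proof (rule cSup_eq_maximum)
  show "sorted_eigenvalues (floquet_matrix \<Gamma> a x\<^sub>0 vs Q \<theta>\<^sub>0) ! (n - 1) \<in> range (band_function \<Gamma> a x\<^sub>0 vs Q n)"
    by (rule range_eqI[of _ _ \<theta>\<^sub>0]) (simp add: band_function_def)
  fix y assume "y \<in> range (band_function \<Gamma> a x\<^sub>0 vs Q n)"
  then obtain \<theta> where y: "y = sorted_eigenvalues (floquet_matrix \<Gamma> a x\<^sub>0 vs Q \<theta>) ! (n - 1)"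
    by (auto simp: band_function_def)
  show "y \<le> sorted_eigenvalues (floquet_matrix \<Gamma> a x\<^sub>0 vs Q \<theta>\<^sub>0) ! (n - 1)"
    unfolding y
  proof (rule eigenvalues_mono_hopping)
    show "hopping \<theta>\<^sub>0 v v \<le> hopping \<theta> v v" for v
      unfolding hopping_def
    proof (rule sum_mono)
      fix e assume e: "e \<in> out_edges v v"
      show "cos (pairing (edge_index a x\<^sub>0 e) \<theta>\<^sub>0) \<le> cos (pairing (edge_index a x\<^sub>0 e) \<theta>)"
      proof (cases "edge_index a x\<^sub>0 e = 0")
        case False
        then have "edge_class e \<in> bridges \<Gamma> a x\<^sub>0"
          using e unfolding bridges_def arcs_fundamental_graph
          by (auto simp: class_index_edge_class out_edges_def)
        then have "cos (pairing (edge_index a x\<^sub>0 e) \<theta>\<^sub>0) = - 1"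
          using p unfolding precise_quasimomentum_def by (auto simp: class_index_edge_class)
        then show ?thesis by simp
      qed simp
    qed
  qed (use n in auto)
qed

text \<open>Each edge leaving \<open>vs ! j\<close> has its head over exactly one fundamental
  vertex. The row sums make the constant vector a null vector of the Laplacian at 0 and are the
  absolute row sums in the form bounds.\<close>

lemma sum_hopping_degree:
  assumes j: "j < length vs"
  shows "(\<Sum>k<length vs. hopping 0 (vs ! j) (vs ! k)) = vertex_degree \<Gamma> (vs ! j)"
proof -
  let ?v = "vs ! j"
  note fin = finite_out_edges_degree[OF nth_vs_vertex[OF j]]
  have "{e \<in> oriented_edges \<Gamma>. fst e = ?v} = (\<Union>k\<in>{..<length vs}. out_edges ?v (vs ! k))"
  proof (intro equalityI subsetI)
    fix e assume e: "e \<in> {e \<in> oriented_edges \<Gamma>. fst e = ?v}"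
    then have "fractional_part a x\<^sub>0 (fst (snd e)) \<in> set vs"
      using fractional_part_in_fundamental oriented_edge_vertices(2)[of e] numbering
      unfolding vertex_numbering_def by blast
    then obtain k where "k < length vs" "vs ! k = fractional_part a x\<^sub>0 (fst (snd e))"
      unfolding in_set_conv_nth by blast
    then have "k \<in> {..<length vs}" "e \<in> out_edges ?v (vs ! k)"
      using e unfolding out_edges_def by simp_all
    then show "e \<in> (\<Union>k\<in>{..<length vs}. out_edges ?v (vs ! k))" by (rule UN_I)
  qed (auto simp: out_edges_def)
  then have "card {e \<in> oriented_edges \<Gamma>. fst e = ?v} = card (\<Union>k\<in>{..<length vs}. out_edges ?v (vs ! k))"
    by simp
  also have "\<dots> = (\<Sum>k<length vs. card (out_edges ?v (vs ! k)))"
  proof (rule card_UN_disjoint)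
    show "\<forall>k\<in>{..<length vs}. finite (out_edges ?v (vs ! k))"
    proof
      fix k
      show "finite (out_edges ?v (vs ! k))"
        by (rule finite_subset[OF _ fin(1)]) (auto simp: out_edges_def)
    qed
    show "\<forall>k\<in>{..<length vs}. \<forall>k'\<in>{..<length vs}. k \<noteq> k' \<longrightarrow>
        out_edges ?v (vs ! k) \<inter> out_edges ?v (vs ! k') = {}"
    proof (intro ballI impI)
      fix k k' assume "k \<in> {..<length vs}" "k' \<in> {..<length vs}" "k \<noteq> k'"
      then have "vs ! k \<noteq> vs ! k'" using nth_vs_eq by simp
      then show "out_edges ?v (vs ! k) \<inter> out_edges ?v (vs ! k') = {}"
        unfolding out_edges_def by auto
    qed
  qed simp
  finally show ?thesis unfolding hopping_0 by (simp only: fin(2) of_nat_sum)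
qed

end

section \<open>Bipartite and regular loop graphs\<close>

context periodic_lattice begin

text \<open>Reachability is taken in the symmetric closure, and equality of f at the two endpoints
  is indifferent to orientation. It serves to show that a period acts on the two parts by the same
  sign at every vertex.\<close>

lemma connected_constant:
  assumes const: "\<And>e. e \<in> oriented_edges \<Gamma> \<Longrightarrow> f (fst (snd e)) = f (fst e)"
    and v: "v \<in> vertices \<Gamma>" and w: "w \<in> vertices \<Gamma>"
  shows "f v = f w"
proof -
  let ?G = "with_proj (mk_symmetric (oriented_graph \<Gamma>))"
  have "v \<rightarrow>\<^sup>*\<^bsub>?G\<^esub> w"
    using periodic v w unfolding periodic_graph_def connected_def strongly_connected_def
    by (auto simp: oriented_graph_def mk_symmetric_def)
  then have "(v, w) \<in> rtrancl_on (verts ?G) (arcs_ends ?G)" unfolding reachable_def .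
  then show ?thesis
  proof (induction rule: rtrancl_on.induct)
    case (rtrancl_on_into_rtrancl_on x y z)
    have "(y, z) \<in> parcs (mk_symmetric (oriented_graph \<Gamma>))"
      using rtrancl_on_into_rtrancl_on by simp
    then obtain e where "e \<in> oriented_edges \<Gamma>" "(y, z) = (fst e, fst (snd e)) \<or> (y, z) = (fst (snd e), fst e)"
      unfolding mk_symmetric_def by (auto simp: oriented_graph_def)
    then have "f y = f z" using const[of e] by auto
    with rtrancl_on_into_rtrancl_on show ?case by simp
  qed simp
qed

text \<open>
  In a connected bipartite graph every translation either preserves or exchanges the two parts.
  This gives a character of the lattice with values \<open>\<plusminus> 1\<close>, written as
  \<open>m \<mapsto> cos \<langle>m, \<theta>\<^sub>0\<rangle>\<close> with \<open>\<theta>\<^sub>0\<close> having coordinates in \<open>{0, \<pi>}\<close>.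
\<close>

lemma bipartite_sign:
  assumes bip: "bipartite \<Gamma>" and ne: "vertices \<Gamma> \<noteq> {}"
  obtains \<sigma> :: "real^'n \<Rightarrow> real" and \<theta>\<^sub>0 :: "real^'n" where
    "\<And>v. \<sigma> v = 1 \<or> \<sigma> v = - 1"
    "\<And>e. e \<in> oriented_edges \<Gamma> \<Longrightarrow> \<sigma> (fst (snd e)) = - \<sigma> (fst e)"
    "\<And>m v. v \<in> vertices \<Gamma> \<Longrightarrow> \<sigma> (lattice_vector a m + v) = cos (pairing m \<theta>\<^sub>0) * \<sigma> v"
proof -
  obtain V W where VW: "V \<inter> W = {}" "\<forall>e\<in>edges \<Gamma>. \<exists>u\<in>V. \<exists>v\<in>W. fst e = Upair u v"
    using bip unfolding bipartite_def by blast
  \<comment> \<open>The sign of the part; every point outside V, vertex or not, gets -1.\<close>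
  define \<sigma> :: "real^'n \<Rightarrow> real" where "\<sigma> v = (if v \<in> V then 1 else - 1)" for v
  have s1: "\<sigma> v = 1 \<or> \<sigma> v = - 1" for v by (simp add: \<sigma>_def)
  have sq: "\<sigma> v * \<sigma> v = 1" for v by (simp add: \<sigma>_def)
  have flip: "\<sigma> (fst (snd e)) = - \<sigma> (fst e)" if e: "e \<in> oriented_edges \<Gamma>" for e
  proof -
    obtain u x l b where ex: "e = (u, x, l, b)" by (cases e)
    have "(Upair u x, l) \<in> edges \<Gamma>" using e unfolding ex oriented_edges_def by simp
    then obtain u' v' where "u' \<in> V" "v' \<in> W" "Upair u x = Upair u' v'" using VW(2) by fastforce
    then show ?thesis using VW(1) unfolding ex by (auto simp: \<sigma>_def)
  qed
  obtain v\<^sub>0 where v0: "v\<^sub>0 \<in> vertices \<Gamma>" using ne by blast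
  \<comment> \<open>The sign by which the period \<open>a s\<close> acts, read off at one
    vertex.\<close>
  define \<epsilon> where "\<epsilon> s = \<sigma> (a s + v\<^sub>0) * \<sigma> v\<^sub>0" for s
  have eps: "\<epsilon> s = 1 \<or> \<epsilon> s = - 1" for s using s1[of v\<^sub>0] s1[of "a s + v\<^sub>0"] unfolding \<epsilon>_def by auto
  have shift: "\<sigma> (a s + v) = \<epsilon> s * \<sigma> v" if v: "v \<in> vertices \<Gamma>" for s v
  proof -
    \<comment> \<open>Along an edge both factors on the left change sign, so the product is constant
      on the connected graph.\<close>
    have "\<sigma> (a s + v) * \<sigma> v = \<epsilon> s"
      unfolding \<epsilon>_def
    proof (rule connected_constant[OF _ v v0])
      fix e assume e: "e \<in> oriented_edges \<Gamma>"
      have "translate_edge (a s) e \<in> oriented_edges \<Gamma>"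
        using oriented_edges_translate[of "axis s 1" e] e by (simp add: lattice_vector_axis)
      from flip[OF this] show "\<sigma> (a s + fst (snd e)) * \<sigma> (fst (snd e)) = \<sigma> (a s + fst e) * \<sigma> (fst e)"
        using flip[OF e] by (simp add: fst_translate_edge fst_snd_translate_edge)
    qed
    then have "\<sigma> (a s + v) * (\<sigma> v * \<sigma> v) = \<epsilon> s * \<sigma> v" by (simp add: mult.assoc)
    then show ?thesis unfolding sq by simp
  qed
  define \<theta>\<^sub>0 :: "real^'n" where "\<theta>\<^sub>0 = (\<chi> s. if \<epsilon> s = 1 then 0 else pi)"
  have cos_th: "cos (\<theta>\<^sub>0 $ s) = \<epsilon> s" "sin (\<theta>\<^sub>0 $ s) = 0" for s
    using eps[of s] by (auto simp: \<theta>\<^sub>0_def)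
  have "sin (pairing m \<theta>\<^sub>0) = 0 \<and>
      (\<forall>v\<in>vertices \<Gamma>. \<sigma> (lattice_vector a m + v) = cos (pairing m \<theta>\<^sub>0) * \<sigma> v)" for m
  proof (induction m rule: int_vec_induct)
    case (2 m s)
    have p: "sin (pairing (m + axis s 1) \<theta>\<^sub>0) = \<epsilon> s * sin (pairing m \<theta>\<^sub>0)"
      "cos (pairing (m + axis s 1) \<theta>\<^sub>0) = \<epsilon> s * cos (pairing m \<theta>\<^sub>0)"
      unfolding pairing_add pairing_axis sin_add cos_add cos_th by simp_all
    have "\<sigma> (lattice_vector a (m + axis s 1) + v) = \<epsilon> s * \<sigma> (lattice_vector a m + v)"
      if "v \<in> vertices \<Gamma>" for v
    proof -
      have eq: "lattice_vector a (m + axis s 1) + v = a s + (lattice_vector a m + v)"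
        by (simp add: lattice_vector_add lattice_vector_axis)
      show ?thesis unfolding eq by (rule shift) (simp add: vertices_translate that)
    qed
    then show ?case unfolding p using eps[of s] by auto
  qed simp
  then show thesis using that[of \<sigma> \<theta>\<^sub>0] s1 flip by blast
qed

lemma schroedinger_eq_laplacian:
  assumes "schroedinger \<Gamma> Q = laplacian \<Gamma>" and v: "v \<in> vertices \<Gamma>"
  shows "Q v = 0"
  \<comment> \<open>Applied to the constant function 1, the two operators differ at v by
    \<open>Q v\<close>.\<close>
  using fun_cong[OF fun_cong[OF assms(1), of "\<lambda>_. 1"], of v] v by (simp add: schroedinger_def)

end

section \<open>Extreme eigenvalues and upper band edges of regular loop graphs\<close>

lemma qform_scalar_mat:
  "qform n (complex_of_real c \<cdot>\<^sub>m 1\<^sub>m n) x = c * (\<Sum>i<n. (cmod (x i))\<^sup>2)"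
proof -
  have "(\<Sum>i<n. \<Sum>j<n. cnj (x i) * (complex_of_real c \<cdot>\<^sub>m 1\<^sub>m n) $$ (i, j) * x j)
    = (\<Sum>i<n. \<Sum>j<n. if i = j then complex_of_real c * (x i * cnj (x i)) else 0)"
    by (intro sum.cong refl) auto
  also have "\<dots> = (\<Sum>i<n. complex_of_real (c * (cmod (x i))\<^sup>2))"
    unfolding of_real_mult complex_norm_square by (intro sum.cong refl) simp
  finally show ?thesis unfolding qform_def sum_distrib_left by (simp only: of_real_sum[symmetric] Re_complex_of_real)
qed

lemma hermitian_scalar_diff:
  assumes "hermitian_mat n A"
  shows "hermitian_mat n (complex_of_real c \<cdot>\<^sub>m 1\<^sub>m n - A)"
  unfolding hermitian_mat_def using hermitian_matD[OF assms] hermitian_mat_carrier[OF assms] by auto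

lemma hermitian_scalar: "hermitian_mat n (complex_of_real c \<cdot>\<^sub>m 1\<^sub>m n)"
  unfolding hermitian_mat_def by auto

context loop_floquet begin

text \<open>L and 2\<kappa> - L are \<kappa> minus and plus the hopping matrix, which is nonnegative
  with row sums \<kappa>. Both forms therefore lie between 0 and 2\<kappa> times the squared norm,
  and the constant vector attains 0 for L and 2\<kappa> for 2\<kappa> - L.\<close>

lemma laplacian_extreme_eigenvalues:
  assumes reg: "regular_graph \<Gamma> \<kappa>"
  defines "L \<equiv> floquet_laplacian \<Gamma> a x\<^sub>0 vs 0"
  shows "sorted_eigenvalues L ! 0 = 0"
    and "sorted_eigenvalues (complex_of_real (2 * real \<kappa>) \<cdot>\<^sub>m 1\<^sub>m (length vs) - L) ! (length vs - 1) = 2 * real \<kappa>"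
proof -
  let ?n = "length vs" and ?K = "complex_of_real (real \<kappa>) \<cdot>\<^sub>m 1\<^sub>m (length vs)"
  let ?M = "complex_of_real (2 * real \<kappa>) \<cdot>\<^sub>m 1\<^sub>m (length vs) - L"
  have L: "L \<in> carrier_mat ?n ?n" unfolding L_def by (rule floquet_laplacian_carrier)
  have hL: "hermitian_mat ?n L" unfolding L_def by (rule floquet_laplacian_hermitian)
  have hM: "hermitian_mat ?n ?M" by (rule hermitian_scalar_diff[OF hL])
  have deg: "vertex_degree \<Gamma> (vs ! j) = \<kappa>" if "j < ?n" for j
    using reg nth_vs_vertex[OF that] unfolding regular_graph_def by blast
  have ix: "L $$ (j, k) = complex_of_real ((if j = k then real \<kappa> else 0) - hopping 0 (vs ! j) (vs ! k))"
    if "j < ?n" "k < ?n" for j k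
    unfolding L_def floquet_laplacian_index[OF that] deg[OF that(1)] ..
  have ixM: "?M $$ (j, k) = complex_of_real ((if j = k then real \<kappa> else 0) + hopping 0 (vs ! j) (vs ! k))"
    if "j < ?n" "k < ?n" for j k
    using that L by (simp add: ix)
  have hop: "(\<Sum>k<?n. hopping 0 (vs ! j) (vs ! k)) = real \<kappa>" if "j < ?n" for j
    unfolding sum_hopping_degree[OF that] deg[OF that] ..
  have nonneg: "hopping 0 v w \<ge> 0" for v w unfolding hopping_0 by simp
  have row: "(\<Sum>i<?n. (\<Sum>j<?n. cmod (X $$ (i, j) - ?K $$ (i, j))) * (cmod (x i))\<^sup>2)
      = real \<kappa> * (\<Sum>i<?n. (cmod (x i))\<^sup>2)"
    if "\<And>i j. i < ?n \<Longrightarrow> j < ?n \<Longrightarrow> cmod (X $$ (i, j) - ?K $$ (i, j)) = hopping 0 (vs ! i) (vs ! j)" for X x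
    unfolding sum_distrib_left
  proof (intro sum.cong refl)
    fix i assume "i \<in> {..<?n}"
    then have i: "i < ?n" by simp
    have "(\<Sum>j<?n. cmod (X $$ (i, j) - ?K $$ (i, j))) = (\<Sum>j<?n. hopping 0 (vs ! i) (vs ! j))"
      by (intro sum.cong refl) (simp only: that[OF i] lessThan_iff)
    then show "(\<Sum>j<?n. cmod (X $$ (i, j) - ?K $$ (i, j))) * (cmod (x i))\<^sup>2 = real \<kappa> * (cmod (x i))\<^sup>2"
      unfolding hop[OF i] by simp
  qed
  have qL: "\<bar>qform ?n L x - real \<kappa> * (\<Sum>i<?n. (cmod (x i))\<^sup>2)\<bar> \<le> real \<kappa> * (\<Sum>i<?n. (cmod (x i))\<^sup>2)" for x
  proof -
    have "cmod (L $$ (i, j) - ?K $$ (i, j)) = hopping 0 (vs ! i) (vs ! j)" if "i < ?n" "j < ?n" for i j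
      using that nonneg by (simp add: ix)
    from row[OF this] show ?thesis
      using qform_diff_le_row_sums[OF hL hermitian_scalar[of _ "real \<kappa>"], of x] unfolding qform_scalar_mat by simp
  qed
  have qM: "\<bar>qform ?n ?M x - real \<kappa> * (\<Sum>i<?n. (cmod (x i))\<^sup>2)\<bar> \<le> real \<kappa> * (\<Sum>i<?n. (cmod (x i))\<^sup>2)" for x
  proof -
    have "cmod (?M $$ (i, j) - ?K $$ (i, j)) = hopping 0 (vs ! i) (vs ! j)" if "i < ?n" "j < ?n" for i j
      unfolding ixM[OF that] using that nonneg by simp
    from row[OF this] show ?thesis
      using qform_diff_le_row_sums[OF hM hermitian_scalar[of _ "real \<kappa>"], of x] unfolding qform_scalar_mat by simp
  qed
  define v :: "complex vec" where "v = Matrix.vec ?n (\<lambda>_. 1)"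
  have v: "v \<in> carrier_vec ?n" "v \<noteq> 0\<^sub>v ?n"
  proof -
    show "v \<in> carrier_vec ?n" unfolding v_def by simp
    have "vec_index v 0 \<noteq> vec_index (0\<^sub>v ?n) 0" unfolding v_def using vs_nonempty by simp
    then show "v \<noteq> 0\<^sub>v ?n" by metis
  qed
  have mult: "vec_index (X *\<^sub>v v) j = (\<Sum>k<?n. X $$ (j, k))" if "X \<in> carrier_mat ?n ?n" "j < ?n" for X j
    using that by (auto simp: v_def scalar_prod_def lessThan_atLeast0 intro!: sum.cong)
  have "L *\<^sub>v v = complex_of_real 0 \<cdot>\<^sub>v v"
  proof (rule eq_vecI)
    fix j assume "j < dim_vec (complex_of_real 0 \<cdot>\<^sub>v v)"
    then have j: "j < ?n" by (simp add: v_def)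
    have "(\<Sum>k<?n. L $$ (j, k)) = complex_of_real (\<Sum>k<?n. (if j = k then real \<kappa> else 0) - hopping 0 (vs ! j) (vs ! k))"
      unfolding of_real_sum by (intro sum.cong refl) (simp only: ix j lessThan_iff)
    also have "\<dots> = 0" unfolding sum_subtractf hop[OF j] using j by simp
    finally show "vec_index (L *\<^sub>v v) j = vec_index (complex_of_real 0 \<cdot>\<^sub>v v) j"
      unfolding mult[OF L j] using j by (simp add: v_def)
  qed (use L v in auto)
  moreover have "0 * (\<Sum>i<?n. (cmod (x i))\<^sup>2) \<le> qform ?n L x" for x
    using qL[of x] by (simp add: abs_le_iff)
  ultimately show "sorted_eigenvalues L ! 0 = 0"
    using sorted_eigenvalue_first[OF hL vs_nonempty _ v, of 0] by simp
  have "?M *\<^sub>v v = complex_of_real (2 * real \<kappa>) \<cdot>\<^sub>v v"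
  proof (rule eq_vecI)
    fix j assume "j < dim_vec (complex_of_real (2 * real \<kappa>) \<cdot>\<^sub>v v)"
    then have j: "j < ?n" by (simp add: v_def)
    have "(\<Sum>k<?n. ?M $$ (j, k)) = complex_of_real (\<Sum>k<?n. (if j = k then real \<kappa> else 0) + hopping 0 (vs ! j) (vs ! k))"
      unfolding of_real_sum by (intro sum.cong refl) (simp only: ixM j lessThan_iff)
    also have "\<dots> = complex_of_real (2 * real \<kappa>)" unfolding sum.distrib hop[OF j] using j by simp
    finally show "vec_index (?M *\<^sub>v v) j = vec_index (complex_of_real (2 * real \<kappa>) \<cdot>\<^sub>v v) j"
      unfolding mult[OF hermitian_mat_carrier[OF hM] j] using j by (simp add: v_def)
  qed (use L v in auto)
  moreover have "qform ?n ?M x \<le> 2 * real \<kappa> * (\<Sum>i<?n. (cmod (x i))\<^sup>2)" for x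
    using qM[of x] by (simp add: abs_le_iff)
  ultimately show "sorted_eigenvalues ?M ! (?n - 1) = 2 * real \<kappa>"
    using sorted_eigenvalue_last[OF hM vs_nonempty _ v] by blast
qed

text \<open>At \<open>\<theta>\<^sub>0\<close> an edge from v to a translate of w has cosine
  \<open>- (\<sigma> v * \<sigma> w)\<close>, so conjugation by the signs reverses the hopping
  matrix. As all degrees are \<kappa>, the Laplacian at \<open>\<theta>\<^sub>0\<close> is thus
  conjugate to \<kappa> plus the hopping matrix at 0, which is 2\<kappa> - \<Delta>(0). For v = w
  the cosine is -1, which makes \<open>\<theta>\<^sub>0\<close> precise.\<close>

lemma bipartite_regular_band_max:
  assumes bip: "bipartite \<Gamma>" and reg: "regular_graph \<Gamma> \<kappa>"
    and Q: "\<And>v. v \<in> vertices \<Gamma> \<Longrightarrow> Q v = 0" and n: "1 \<le> n" "n \<le> length vs"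
  shows "band_max \<Gamma> a x\<^sub>0 vs Q n = sorted_eigenvalues
    (complex_of_real (2 * real \<kappa>) \<cdot>\<^sub>m 1\<^sub>m (length vs) - floquet_laplacian \<Gamma> a x\<^sub>0 vs 0) ! (n - 1)"
proof -
  let ?n = "length vs"
  have "vertices \<Gamma> \<noteq> {}" using nth_vs_vertex[OF vs_nonempty] by blast
  from bipartite_sign[OF bip this] obtain \<sigma> \<theta>\<^sub>0 where
    s1: "\<And>v. \<sigma> v = 1 \<or> \<sigma> v = - 1"
    and flip: "\<And>e. e \<in> oriented_edges \<Gamma> \<Longrightarrow> \<sigma> (fst (snd e)) = - \<sigma> (fst e)"
    and trans: "\<And>m v. v \<in> vertices \<Gamma> \<Longrightarrow> \<sigma> (lattice_vector a m + v) = cos (pairing m \<theta>\<^sub>0) * \<sigma> v"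
    by metis
  have sq: "\<sigma> v * \<sigma> v = 1" for v using s1[of v] by auto
  \<comment> \<open>The head of e is w shifted by the index of e: \<open>trans\<close> expresses its
    sign by that of w, \<open>flip\<close> by that of v.\<close>
  have cos_edge: "cos (pairing (edge_index a x\<^sub>0 e) \<theta>\<^sub>0) = - (\<sigma> v * \<sigma> w)"
    if v: "v \<in> fundamental_vertices \<Gamma> a x\<^sub>0" and w: "w \<in> vertices \<Gamma>" and e: "e \<in> out_edges v w" for v w e
  proof -
    have "cos (pairing (edge_index a x\<^sub>0 e) \<theta>\<^sub>0) * \<sigma> w = - \<sigma> v"
      using trans[OF w, of "edge_index a x\<^sub>0 e"] flip[of e] e unfolding out_edges_head(2)[OF v e, symmetric]
      by (simp add: out_edges_def)
    then have "cos (pairing (edge_index a x\<^sub>0 e) \<theta>\<^sub>0) * (\<sigma> w * \<sigma> w) = - (\<sigma> v * \<sigma> w)"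
      by (simp add: mult.assoc[symmetric])
    then show ?thesis unfolding sq by simp
  qed
  have hop: "hopping \<theta>\<^sub>0 v w = - (\<sigma> v * \<sigma> w) * hopping 0 v w"
    if "v \<in> fundamental_vertices \<Gamma> a x\<^sub>0" "w \<in> vertices \<Gamma>" for v w
    unfolding hopping_0 unfolding hopping_def using cos_edge[OF that] by simp
  have precise: "precise_quasimomentum \<Gamma> a x\<^sub>0 \<theta>\<^sub>0"
    unfolding precise_quasimomentum_def
  proof
    fix E assume E: "E \<in> bridges \<Gamma> a x\<^sub>0"
    then have "E \<in> arcs (fundamental_graph \<Gamma> a x\<^sub>0)"
      and th: "tail (fundamental_graph \<Gamma> a x\<^sub>0) E = head (fundamental_graph \<Gamma> a x\<^sub>0) E"
      using loop unfolding loop_fundamental_graph_def bridges_def by auto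
    then obtain e' where e': "e' \<in> oriented_edges \<Gamma>" "E = edge_class e'"
      unfolding arcs_fundamental_graph by blast
    define v where "v = tail (fundamental_graph \<Gamma> a x\<^sub>0) E"
    have v: "v \<in> fundamental_vertices \<Gamma> a x\<^sub>0"
      unfolding v_def e'(2) tail_edge_class
      by (rule fractional_part_in_fundamental[OF oriented_edge_vertices(1)[OF e'(1)]])
    \<comment> \<open>A bridge is a loop of the fundamental graph, so it has a representative
      running from v to a translate of v.\<close>
    have "E \<in> edge_class ` out_edges v v"
      unfolding bij_betw_imp_surj_on[OF edge_class_bij[OF v]]
      using th \<open>E \<in> arcs (fundamental_graph \<Gamma> a x\<^sub>0)\<close> v_def by auto
    then obtain e where e: "e \<in> out_edges v v" "E = edge_class e" by blast
    have "v \<in> vertices \<Gamma>" using v unfolding fundamental_vertices_def by blast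
    then show "cos (pairing (class_index a x\<^sub>0 E) \<theta>\<^sub>0) = - 1"
      using cos_edge[OF v _ e(1)] sq[of v] unfolding e(2) class_index_edge_class by simp
  qed
  let ?A = "floquet_laplacian \<Gamma> a x\<^sub>0 vs \<theta>\<^sub>0"
  let ?B = "complex_of_real (2 * real \<kappa>) \<cdot>\<^sub>m 1\<^sub>m ?n - floquet_laplacian \<Gamma> a x\<^sub>0 vs 0"
  define D where "D = Matrix.mat ?n ?n (\<lambda>(i, j). if i = j then complex_of_real (\<sigma> (vs ! i)) else 0)"
  have D: "D \<in> carrier_mat ?n ?n" unfolding D_def by simp
  have B: "?B \<in> carrier_mat ?n ?n" using floquet_laplacian_carrier by (rule minus_carrier_mat)
  have Dl: "(D * X) $$ (i, j) = complex_of_real (\<sigma> (vs ! i)) * X $$ (i, j)"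
    if "X \<in> carrier_mat ?n ?n" "i < ?n" "j < ?n" for X i j
  proof -
    have "(D * X) $$ (i, j) = (\<Sum>k<?n. if k = i then complex_of_real (\<sigma> (vs ! i)) * X $$ (i, j) else 0)"
      unfolding index_mult_mat_sum[OF D that] by (intro sum.cong refl) (use that in \<open>auto simp: D_def\<close>)
    then show ?thesis using that by simp
  qed
  have Dr: "(X * D) $$ (i, j) = X $$ (i, j) * complex_of_real (\<sigma> (vs ! j))"
    if "X \<in> carrier_mat ?n ?n" "i < ?n" "j < ?n" for X i j
  proof -
    have "(X * D) $$ (i, j) = (\<Sum>k<?n. if k = j then X $$ (i, j) * complex_of_real (\<sigma> (vs ! j)) else 0)"
      unfolding index_mult_mat_sum[OF that(1) D that(2,3)]
      by (intro sum.cong refl) (use that in \<open>auto simp: D_def\<close>)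
    then show ?thesis using that by simp
  qed
  have DD: "D * D = 1\<^sub>m ?n"
  proof (rule eq_matI)
    fix i j assume "i < dim_row (1\<^sub>m ?n :: complex mat)" "j < dim_col (1\<^sub>m ?n :: complex mat)"
    then have ij: "i < ?n" "j < ?n" by auto
    show "(D * D) $$ (i, j) = 1\<^sub>m ?n $$ (i, j)"
      unfolding Dl[OF D ij] using ij sq[of "vs ! i"] by (auto simp: D_def simp flip: of_real_mult)
  qed (use D in auto)
  have DBD: "?A = D * ?B * D"
  proof (rule eq_matI)
    fix i j assume "i < dim_row (D * ?B * D)" "j < dim_col (D * ?B * D)"
    then have ij: "i < ?n" "j < ?n" using D by auto
    have deg: "vertex_degree \<Gamma> (vs ! i) = \<kappa>"
      using reg nth_vs_vertex[OF ij(1)] unfolding regular_graph_def by blast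
    have Bij: "?B $$ (i, j) = complex_of_real ((if i = j then real \<kappa> else 0) + hopping 0 (vs ! i) (vs ! j))"
      using ij deg floquet_laplacian_carrier[of 0] by (auto simp: floquet_laplacian_index)
    have "(D * ?B * D) $$ (i, j) = complex_of_real (\<sigma> (vs ! i) *
        ((if i = j then real \<kappa> else 0) + hopping 0 (vs ! i) (vs ! j)) * \<sigma> (vs ! j))"
      unfolding Dr[OF mult_carrier_mat[OF D B] ij] Dl[OF B ij] Bij by simp
    also have "\<sigma> (vs ! i) * ((if i = j then real \<kappa> else 0) + hopping 0 (vs ! i) (vs ! j)) * \<sigma> (vs ! j)
        = (if i = j then real \<kappa> else 0) - hopping \<theta>\<^sub>0 (vs ! i) (vs ! j)"
      unfolding hop[OF nth_vs[OF ij(1)] nth_vs_vertex[OF ij(2)]]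
      using sq[of "vs ! i"] by (auto simp: algebra_simps)
    finally show "?A $$ (i, j) = (D * ?B * D) $$ (i, j)"
      unfolding floquet_laplacian_index[OF ij] deg by simp
  qed (use D floquet_laplacian_carrier in auto)
  have "similar_mat ?A ?B"
    unfolding similar_mat_def similar_mat_wit_def Let_def
    using D B DD DBD floquet_laplacian_carrier[of \<theta>\<^sub>0] by (intro exI[of _ D]) auto
  then have "sorted_eigenvalues ?A = sorted_eigenvalues ?B" by (rule sorted_eigenvalues_similar)
  moreover have "floquet_matrix \<Gamma> a x\<^sub>0 vs Q \<theta>\<^sub>0 = ?A"
    by (rule floquet_matrix_no_potential) (rule Q)
  ultimately show ?thesis unfolding band_max_eq[OF precise n] by simp
qed

end

text \<open>S and T stand for lower and upper band edges, numbered from 0, the primed ones for the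
  comparison operator. The n-th gap uses \<open>S n\<close> and \<open>T (n - 1)\<close>, so over
  all gaps each edge occurs once except \<open>S 0\<close> and \<open>T (\<nu> - 1)\<close>, which
  the boundary terms supply. The triangle inequality then gives the bound without double
  counting.\<close>

lemma gap_sum_le:
  fixes S T S' T' :: "nat \<Rightarrow> real"
  assumes "\<nu> > 0"
  shows "\<bar>S 0 - S' 0\<bar> + \<bar>T' (\<nu> - 1) - T (\<nu> - 1)\<bar>
      + (\<Sum>n = 1..\<nu> - 1. \<bar>(S n - T (n - 1)) - (S' n - T' (n - 1))\<bar>)
    \<le> (\<Sum>i<\<nu>. \<bar>S i - S' i\<bar>) + (\<Sum>i<\<nu>. \<bar>T i - T' i\<bar>)"
proof -
  obtain m where m: "\<nu> = Suc m" using assms by (cases \<nu>) auto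
  have "(\<Sum>n = 1..m. \<bar>(S n - T (n - 1)) - (S' n - T' (n - 1))\<bar>)
      = (\<Sum>i<m. \<bar>(S (Suc i) - T i) - (S' (Suc i) - T' i)\<bar>)"
    by (rule sum.reindex_bij_witness[of _ Suc "\<lambda>n. n - 1"]) auto
  also have "\<dots> \<le> (\<Sum>i<m. \<bar>S (Suc i) - S' (Suc i)\<bar> + \<bar>T i - T' i\<bar>)"
    by (intro sum_mono) linarith
  finally have "(\<Sum>n = 1..m. \<bar>(S n - T (n - 1)) - (S' n - T' (n - 1))\<bar>)
      \<le> (\<Sum>i<m. \<bar>S (Suc i) - S' (Suc i)\<bar>) + (\<Sum>i<m. \<bar>T i - T' i\<bar>)"
    by (simp only: sum.distrib)
  then show ?thesis
    unfolding m sum.lessThan_Suc_shift[of "\<lambda>i. \<bar>S i - S' i\<bar>"] sum.lessThan_Suc[of "\<lambda>i. \<bar>T i - T' i\<bar>"]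
    by (simp add: abs_minus_commute)
qed

lemma band_sum_le:
  fixes S T S' T' :: "nat \<Rightarrow> real"
  shows "(\<Sum>n = 1..\<nu>. \<bar>(T (n - 1) - S (n - 1)) - (T' (n - 1) - S' (n - 1))\<bar>)
    \<le> (\<Sum>i<\<nu>. \<bar>S i - S' i\<bar>) + (\<Sum>i<\<nu>. \<bar>T i - T' i\<bar>)"
proof -
  have "(\<Sum>n = 1..\<nu>. \<bar>(T (n - 1) - S (n - 1)) - (T' (n - 1) - S' (n - 1))\<bar>)
      = (\<Sum>i<\<nu>. \<bar>(T i - S i) - (T' i - S' i)\<bar>)"
    by (rule sum.reindex_bij_witness[of _ Suc "\<lambda>n. n - 1"]) auto
  also have "\<dots> \<le> (\<Sum>i<\<nu>. \<bar>S i - S' i\<bar> + \<bar>T i - T' i\<bar>)"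
    by (intro sum_mono) linarith
  finally show ?thesis by (simp only: sum.distrib)
qed

theorem theorem6p2:
  fixes \<Gamma> :: "(real^'n, 'l) multigraph" and \<Gamma>' :: "(real^'n, 'k) multigraph"
    and a a' :: "'n \<Rightarrow> real^'n" and x\<^sub>0 x\<^sub>0' :: "real^'n"
    and vs vs' :: "(real^'n) list" and Q Q' :: "real^'n \<Rightarrow> real" and \<nu> :: nat
  assumes "2 \<le> CARD('n)"
    and "loop_graph \<Gamma>" and "loop_fundamental_graph \<Gamma> a x\<^sub>0"
    and "loop_graph \<Gamma>'" and "loop_fundamental_graph \<Gamma>' a' x\<^sub>0'"
    and "vertex_numbering \<Gamma> a x\<^sub>0 vs" and "length vs = \<nu>"
    and "vertex_numbering \<Gamma>' a' x\<^sub>0' vs'" and "length vs' = \<nu>"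
    and "periodic_potential \<Gamma> a Q" and "periodic_potential \<Gamma>' a' Q'"
  shows
    "(\<forall>\<kappa>. bipartite \<Gamma> \<and> bipartite \<Gamma>' \<and> regular_graph \<Gamma> \<kappa> \<and> regular_graph \<Gamma>' \<kappa> \<and>
        schroedinger \<Gamma> Q = laplacian \<Gamma> \<and> schroedinger \<Gamma>' Q' = laplacian \<Gamma>' \<longrightarrow>
        (let C = entry_norm1 (floquet_laplacian \<Gamma> a x\<^sub>0 vs 0 - floquet_laplacian \<Gamma>' a' x\<^sub>0' vs' 0)
         in (\<Sum>n = 1..\<nu> - 1. \<bar>gap_length \<Gamma> a x\<^sub>0 vs Q n - gap_length \<Gamma>' a' x\<^sub>0' vs' Q' n\<bar>) \<le> 4 * C \<and>
            (\<Sum>n = 1..\<nu>. \<bar>band_length \<Gamma> a x\<^sub>0 vs Q n - band_length \<Gamma>' a' x\<^sub>0' vs' Q' n\<bar>) \<le> 4 * C)) \<and>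
     (\<forall>\<kappa> \<theta>\<^sub>0. precise \<Gamma> a x\<^sub>0 \<and> precise_quasimomentum \<Gamma> a x\<^sub>0 \<theta>\<^sub>0 \<and>
        bipartite \<Gamma>' \<and> regular_graph \<Gamma>' \<kappa> \<and> schroedinger \<Gamma>' Q' = laplacian \<Gamma>' \<longrightarrow>
        (let C = entry_norm1 (floquet_matrix \<Gamma> a x\<^sub>0 vs Q 0 - floquet_laplacian \<Gamma>' a' x\<^sub>0' vs' 0) +
                 entry_norm1 (floquet_matrix \<Gamma> a x\<^sub>0 vs Q \<theta>\<^sub>0 + floquet_laplacian \<Gamma>' a' x\<^sub>0' vs' 0 -
                              of_nat (2 * \<kappa>) \<cdot>\<^sub>m 1\<^sub>m \<nu>)
         in \<bar>band_min \<Gamma> a x\<^sub>0 vs Q 1\<bar> + \<bar>2 * real \<kappa> - band_max \<Gamma> a x\<^sub>0 vs Q \<nu>\<bar> +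
              (\<Sum>n = 1..\<nu> - 1. \<bar>gap_length \<Gamma> a x\<^sub>0 vs Q n - gap_length \<Gamma>' a' x\<^sub>0' vs' Q' n\<bar>) \<le> 2 * C \<and>
            (\<Sum>n = 1..\<nu>. \<bar>band_length \<Gamma> a x\<^sub>0 vs Q n - band_length \<Gamma>' a' x\<^sub>0' vs' Q' n\<bar>) \<le> 2 * C))"
proof -
  interpret G: loop_floquet \<Gamma> a x\<^sub>0 vs
    using assms by unfold_locales (auto simp: loop_graph_def loop_fundamental_graph_def)
  interpret G': loop_floquet \<Gamma>' a' x\<^sub>0' vs'
    using assms by unfold_locales (auto simp: loop_graph_def loop_fundamental_graph_def)
  have \<nu>: "\<nu> > 0" using G.vs_nonempty assms(7) by simp
  note len = assms(7,9)
  define L where "L = floquet_laplacian \<Gamma> a x\<^sub>0 vs 0"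
  define L' where "L' = floquet_laplacian \<Gamma>' a' x\<^sub>0' vs' 0"
  let ?I = "\<lambda>\<kappa>. complex_of_real (2 * real \<kappa>) \<cdot>\<^sub>m 1\<^sub>m \<nu>"
  have hL: "hermitian_mat \<nu> L" and hL': "hermitian_mat \<nu> L'"
    using G.floquet_laplacian_hermitian[of 0] G'.floquet_laplacian_hermitian[of 0]
    unfolding len L_def L'_def by auto
  note Lc = hermitian_mat_carrier[OF hL] and Lc' = hermitian_mat_carrier[OF hL']
  have hH: "hermitian_mat \<nu> (floquet_matrix \<Gamma> a x\<^sub>0 vs Q \<theta>)" for \<theta>
    using G.floquet_matrix_hermitian[of Q \<theta>] unfolding len .
  let ?N = "{1..\<nu>}"
  have bands': "band_min \<Gamma>' a' x\<^sub>0' vs' Q' n = sorted_eigenvalues L' ! (n - 1)"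
    "band_max \<Gamma>' a' x\<^sub>0' vs' Q' n = sorted_eigenvalues (?I \<kappa> - L') ! (n - 1)"
    if "bipartite \<Gamma>'" "regular_graph \<Gamma>' \<kappa>" "schroedinger \<Gamma>' Q' = laplacian \<Gamma>'" "n \<in> ?N" for \<kappa> n
  proof -
    note Q0 = G'.schroedinger_eq_laplacian[OF that(3)]
    have n: "1 \<le> n" "n \<le> length vs'" using that(4) len by auto
    have "floquet_matrix \<Gamma>' a' x\<^sub>0' vs' Q' 0 = L'"
      unfolding L'_def by (rule G'.floquet_matrix_no_potential) (rule Q0)
    then show "band_min \<Gamma>' a' x\<^sub>0' vs' Q' n = sorted_eigenvalues L' ! (n - 1)"
      unfolding G'.band_min_eq[OF n] by simp
    show "band_max \<Gamma>' a' x\<^sub>0' vs' Q' n = sorted_eigenvalues (?I \<kappa> - L') ! (n - 1)"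
      using G'.bipartite_regular_band_max[OF that(1,2) _ n] Q0 unfolding len L'_def by blast
  qed
  \<comment> \<open>Stated for arbitrary edge sequences, since the two parts of the theorem express
    the edges of H by different matrices.\<close>
  have gap_eq: "(\<Sum>n = 1..\<nu> - 1. \<bar>gap_length \<Gamma> a x\<^sub>0 vs Q n - gap_length \<Gamma>' a' x\<^sub>0' vs' Q' n\<bar>)
      = (\<Sum>n = 1..\<nu> - 1. \<bar>(S n - T (n - 1)) - (S' n - T' (n - 1))\<bar>)"
    and band_eq: "(\<Sum>n = 1..\<nu>. \<bar>band_length \<Gamma> a x\<^sub>0 vs Q n - band_length \<Gamma>' a' x\<^sub>0' vs' Q' n\<bar>)
      = (\<Sum>n = 1..\<nu>. \<bar>(T (n - 1) - S (n - 1)) - (T' (n - 1) - S' (n - 1))\<bar>)"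
    if "\<forall>n\<in>?N. band_min \<Gamma> a x\<^sub>0 vs Q n = S (n - 1)"
      "\<forall>n\<in>?N. band_max \<Gamma> a x\<^sub>0 vs Q n = T (n - 1)"
      "\<forall>n\<in>?N. band_min \<Gamma>' a' x\<^sub>0' vs' Q' n = S' (n - 1)"
      "\<forall>n\<in>?N. band_max \<Gamma>' a' x\<^sub>0' vs' Q' n = T' (n - 1)"
    for S T S' T' :: "nat \<Rightarrow> real"
  proof -
    show "(\<Sum>n = 1..\<nu> - 1. \<bar>gap_length \<Gamma> a x\<^sub>0 vs Q n - gap_length \<Gamma>' a' x\<^sub>0' vs' Q' n\<bar>)
        = (\<Sum>n = 1..\<nu> - 1. \<bar>(S n - T (n - 1)) - (S' n - T' (n - 1))\<bar>)"
    proof (intro sum.cong refl)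
      fix n assume "n \<in> {1..\<nu> - 1}"
      then have "n \<in> ?N" "n + 1 \<in> ?N" using \<nu> by auto
      then show "\<bar>gap_length \<Gamma> a x\<^sub>0 vs Q n - gap_length \<Gamma>' a' x\<^sub>0' vs' Q' n\<bar>
          = \<bar>(S n - T (n - 1)) - (S' n - T' (n - 1))\<bar>"
        unfolding gap_length_def by (simp only: that[rule_format] add_diff_cancel_right')
    qed
    show "(\<Sum>n = 1..\<nu>. \<bar>band_length \<Gamma> a x\<^sub>0 vs Q n - band_length \<Gamma>' a' x\<^sub>0' vs' Q' n\<bar>)
        = (\<Sum>n = 1..\<nu>. \<bar>(T (n - 1) - S (n - 1)) - (T' (n - 1) - S' (n - 1))\<bar>)"
      unfolding band_length_def by (intro sum.cong refl) (simp only: that[rule_format])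
  qed
  show ?thesis
  proof (intro conjI allI impI; elim conjE)
    fix \<kappa>
    assume h: "bipartite \<Gamma>" "bipartite \<Gamma>'" "regular_graph \<Gamma> \<kappa>" "regular_graph \<Gamma>' \<kappa>"
      "schroedinger \<Gamma> Q = laplacian \<Gamma>" "schroedinger \<Gamma>' Q' = laplacian \<Gamma>'"
    have bands: "band_min \<Gamma> a x\<^sub>0 vs Q n = sorted_eigenvalues L ! (n - 1)"
      "band_max \<Gamma> a x\<^sub>0 vs Q n = sorted_eigenvalues (?I \<kappa> - L) ! (n - 1)" if "n \<in> ?N" for n
    proof -
      note Q0 = G.schroedinger_eq_laplacian[OF h(5)]
      have n: "1 \<le> n" "n \<le> length vs" using that len by auto
      have "floquet_matrix \<Gamma> a x\<^sub>0 vs Q 0 = L"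
        unfolding L_def by (rule G.floquet_matrix_no_potential) (rule Q0)
      then show "band_min \<Gamma> a x\<^sub>0 vs Q n = sorted_eigenvalues L ! (n - 1)"
        unfolding G.band_min_eq[OF n] by simp
      show "band_max \<Gamma> a x\<^sub>0 vs Q n = sorted_eigenvalues (?I \<kappa> - L) ! (n - 1)"
        using G.bipartite_regular_band_max[OF h(1,3) _ n] Q0 unfolding len L_def by blast
    qed
    define C where "C = entry_norm1 (L - L')"
    \<comment> \<open>The scalar 2\<kappa> cancels up to sign, so the upper edges are perturbed by
      the same norm C as the lower ones.\<close>
    have "entry_norm1 ((?I \<kappa> - L) - (?I \<kappa> - L')) = C"
      unfolding entry_norm1_def C_def using Lc Lc'
      by (auto intro!: sum.cong simp: norm_minus_commute)
    then have sums: "(\<Sum>i<\<nu>. \<bar>sorted_eigenvalues L ! i - sorted_eigenvalues L' ! i\<bar>) \<le> 2 * C"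
      "(\<Sum>i<\<nu>. \<bar>sorted_eigenvalues (?I \<kappa> - L) ! i - sorted_eigenvalues (?I \<kappa> - L') ! i\<bar>) \<le> 2 * C"
      using sum_sorted_eigenvalues_diff_le[OF hL hL']
        sum_sorted_eigenvalues_diff_le[OF hermitian_scalar_diff[OF hL] hermitian_scalar_diff[OF hL'], of "2 * real \<kappa>" "2 * real \<kappa>"]
      unfolding C_def by auto
    have b: "\<forall>n\<in>?N. band_min \<Gamma> a x\<^sub>0 vs Q n = sorted_eigenvalues (L) ! (n - 1)"
      "\<forall>n\<in>?N. band_max \<Gamma> a x\<^sub>0 vs Q n = sorted_eigenvalues (?I \<kappa> - L) ! (n - 1)"
      "\<forall>n\<in>?N. band_min \<Gamma>' a' x\<^sub>0' vs' Q' n = sorted_eigenvalues L' ! (n - 1)"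
      "\<forall>n\<in>?N. band_max \<Gamma>' a' x\<^sub>0' vs' Q' n = sorted_eigenvalues (?I \<kappa> - L') ! (n - 1)"
      using bands bands'[OF h(2,4,6)] by blast+
    \<comment> \<open>The two eigenvalue sums contribute 2C each; the nonnegative boundary terms of
      \<open>gap_sum_le\<close> are dropped here.\<close>
    show "let C = entry_norm1 (floquet_laplacian \<Gamma> a x\<^sub>0 vs 0 - floquet_laplacian \<Gamma>' a' x\<^sub>0' vs' 0)
         in (\<Sum>n = 1..\<nu> - 1. \<bar>gap_length \<Gamma> a x\<^sub>0 vs Q n - gap_length \<Gamma>' a' x\<^sub>0' vs' Q' n\<bar>) \<le> 4 * C \<and>
            (\<Sum>n = 1..\<nu>. \<bar>band_length \<Gamma> a x\<^sub>0 vs Q n - band_length \<Gamma>' a' x\<^sub>0' vs' Q' n\<bar>) \<le> 4 * C"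
      unfolding Let_def gap_eq[OF b] band_eq[OF b] L_def[symmetric] L'_def[symmetric] C_def[symmetric]
      using sums gap_sum_le[OF \<nu>, of "(!) (sorted_eigenvalues L)" "(!) (sorted_eigenvalues L')"
          "(!) (sorted_eigenvalues (?I \<kappa> - L'))" "(!) (sorted_eigenvalues (?I \<kappa> - L))"]
        band_sum_le[of "(!) (sorted_eigenvalues (?I \<kappa> - L))" "(!) (sorted_eigenvalues L)"
          "(!) (sorted_eigenvalues (?I \<kappa> - L'))" "(!) (sorted_eigenvalues L')" \<nu>]
      by (intro conjI) linarith+
  next
    fix \<kappa> \<theta>\<^sub>0
    assume h: "precise \<Gamma> a x\<^sub>0" "precise_quasimomentum \<Gamma> a x\<^sub>0 \<theta>\<^sub>0" "bipartite \<Gamma>'"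
      "regular_graph \<Gamma>' \<kappa>" "schroedinger \<Gamma>' Q' = laplacian \<Gamma>'"
    let ?H = "floquet_matrix \<Gamma> a x\<^sub>0 vs Q"
    have bands: "band_min \<Gamma> a x\<^sub>0 vs Q n = sorted_eigenvalues (?H 0) ! (n - 1)"
      "band_max \<Gamma> a x\<^sub>0 vs Q n = sorted_eigenvalues (?H \<theta>\<^sub>0) ! (n - 1)" if "n \<in> ?N" for n
      using that len G.band_min_eq[of n Q] G.band_max_eq[OF h(2), of n Q] by auto
    define C\<^sub>1 where "C\<^sub>1 = entry_norm1 (?H 0 - L')"
    define C\<^sub>2 where "C\<^sub>2 = entry_norm1 (?H \<theta>\<^sub>0 + L' - of_nat (2 * \<kappa>) \<cdot>\<^sub>m 1\<^sub>m \<nu>)"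
    \<comment> \<open>The upper edges of the comparison operator come from 2\<kappa> - L', which is
      why L' enters the second norm of C with a plus sign.\<close>
    have "?H \<theta>\<^sub>0 - (?I \<kappa> - L') = ?H \<theta>\<^sub>0 + L' - of_nat (2 * \<kappa>) \<cdot>\<^sub>m 1\<^sub>m \<nu>"
      using hermitian_mat_carrier[OF hH[of \<theta>\<^sub>0]] Lc' by (intro eq_matI) auto
    then have sums: "(\<Sum>i<\<nu>. \<bar>sorted_eigenvalues (?H 0) ! i - sorted_eigenvalues L' ! i\<bar>) \<le> 2 * C\<^sub>1"
      "(\<Sum>i<\<nu>. \<bar>sorted_eigenvalues (?H \<theta>\<^sub>0) ! i - sorted_eigenvalues (?I \<kappa> - L') ! i\<bar>) \<le> 2 * C\<^sub>2"
      using sum_sorted_eigenvalues_diff_le[OF hH[of 0] hL']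
        sum_sorted_eigenvalues_diff_le[OF hH[of \<theta>\<^sub>0] hermitian_scalar_diff[OF hL'], of "2 * real \<kappa>"]
      unfolding C\<^sub>1_def C\<^sub>2_def by auto
    \<comment> \<open>With these values the boundary terms of \<open>gap_sum_le\<close> become the
      two extra terms of (ii).\<close>
    have ends: "sorted_eigenvalues L' ! 0 = 0" "sorted_eigenvalues (?I \<kappa> - L') ! (\<nu> - 1) = 2 * real \<kappa>"
      using G'.laplacian_extreme_eigenvalues[OF h(4)] unfolding len L'_def by auto
    have first_last: "band_min \<Gamma> a x\<^sub>0 vs Q 1 = sorted_eigenvalues (?H 0) ! 0"
      "band_max \<Gamma> a x\<^sub>0 vs Q \<nu> = sorted_eigenvalues (?H \<theta>\<^sub>0) ! (\<nu> - 1)"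
      using bands(1)[of 1] bands(2)[of \<nu>] \<nu> by auto
    have b: "\<forall>n\<in>?N. band_min \<Gamma> a x\<^sub>0 vs Q n = sorted_eigenvalues (?H 0) ! (n - 1)"
      "\<forall>n\<in>?N. band_max \<Gamma> a x\<^sub>0 vs Q n = sorted_eigenvalues (?H \<theta>\<^sub>0) ! (n - 1)"
      "\<forall>n\<in>?N. band_min \<Gamma>' a' x\<^sub>0' vs' Q' n = sorted_eigenvalues L' ! (n - 1)"
      "\<forall>n\<in>?N. band_max \<Gamma>' a' x\<^sub>0' vs' Q' n = sorted_eigenvalues (?I \<kappa> - L') ! (n - 1)"
      using bands bands'[OF h(3-5)] by blast+
    note gap = gap_sum_le[OF \<nu>, of "(!) (sorted_eigenvalues (?H 0))" "(!) (sorted_eigenvalues L')"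
        "(!) (sorted_eigenvalues (?I \<kappa> - L'))" "(!) (sorted_eigenvalues (?H \<theta>\<^sub>0))",
        unfolded ends diff_0_right]
    note band = band_sum_le[of "(!) (sorted_eigenvalues (?H \<theta>\<^sub>0))" "(!) (sorted_eigenvalues (?H 0))"
        "(!) (sorted_eigenvalues (?I \<kappa> - L'))" "(!) (sorted_eigenvalues L')" \<nu>]
    have total: "(\<Sum>i<\<nu>. \<bar>sorted_eigenvalues (?H 0) ! i - sorted_eigenvalues L' ! i\<bar>)
        + (\<Sum>i<\<nu>. \<bar>sorted_eigenvalues (?H \<theta>\<^sub>0) ! i - sorted_eigenvalues (?I \<kappa> - L') ! i\<bar>) \<le> 2 * (C\<^sub>1 + C\<^sub>2)"
      unfolding distrib_left by (rule add_mono[OF sums])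
    show "let C = entry_norm1 (floquet_matrix \<Gamma> a x\<^sub>0 vs Q 0 - floquet_laplacian \<Gamma>' a' x\<^sub>0' vs' 0) +
                 entry_norm1 (floquet_matrix \<Gamma> a x\<^sub>0 vs Q \<theta>\<^sub>0 + floquet_laplacian \<Gamma>' a' x\<^sub>0' vs' 0 -
                              of_nat (2 * \<kappa>) \<cdot>\<^sub>m 1\<^sub>m \<nu>)
         in \<bar>band_min \<Gamma> a x\<^sub>0 vs Q 1\<bar> + \<bar>2 * real \<kappa> - band_max \<Gamma> a x\<^sub>0 vs Q \<nu>\<bar> +
              (\<Sum>n = 1..\<nu> - 1. \<bar>gap_length \<Gamma> a x\<^sub>0 vs Q n - gap_length \<Gamma>' a' x\<^sub>0' vs' Q' n\<bar>) \<le> 2 * C \<and>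
            (\<Sum>n = 1..\<nu>. \<bar>band_length \<Gamma> a x\<^sub>0 vs Q n - band_length \<Gamma>' a' x\<^sub>0' vs' Q' n\<bar>) \<le> 2 * C"
      unfolding Let_def gap_eq[OF b] band_eq[OF b] first_last L'_def[symmetric] C\<^sub>1_def[symmetric] C\<^sub>2_def[symmetric]
      by (intro conjI order_trans[OF gap total] order_trans[OF band total])
  qed
qed

end
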